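(* Let ${\mathcal R}$ be a similarity relation, $\mu$ a cut value, and $t,s$ higher-order patterns. If there exists an $({\mathcal R},\mu)$-unifier $\tau$ of $t$ and $s$ with degree $\mathfrak{d}_\tau\ge\mu$, then $\mathsf{HOPSU}$, started on $\{t\simeq^?_{{\mathcal R},\mu}s\};\varepsilon;1$, stops with a configuration $\emptyset;\sigma;\mathfrak{d}$ such that $\sigma\preceq^{\mathit{Dom}(\tau)}_{{\mathcal R},\mu}\tau$ and $\mathfrak{d}\ge\mathfrak{d}_\tau$.
   Context: Terms: simply typed $\lambda$-terms over disjoint countably infinite sets $\mathcal{V}$ (typed variables) and $\mathcal{F}$ (typed constants), types $\tau::=\delta\mid\tau\to\tau$. Terms are identified modulo $\alpha$, kept $\beta$-normal, and $\eta$-expanded except that arguments of free variables are kept $\eta$-normal (i.e. are bound variables); a term is written $\lambda x_1,\dots,x_n.h(t_1,\dots,t_m)$ with head $h$. Free variables are written $F,G,H,X,Y,\dots$, bound variables $x,y,z,\dots$. A higher-order pattern is a term where every free variable occurrence is applied to a list of pairwise distinct bound variables; all terms in problems and substitutions are higher-order patterns. Substitutions $\sigma$ are type-preserving maps with finite domain $\mathit{Dom}(\sigma)=\{X\mid X\sigma\neq X\}$, applied postfix ($t\sigma$, capture-avoiding, followed by $\beta$-normalization); $\sigma\vartheta$ means first $\sigma$ then $\vartheta$; $\varepsilon$ is the identity; $\varphi|_V$ is the restriction to $V$; $\mathtt{fv}(t)$ is the set of free variables. Fuzzy setting: T-norm $\wedge=\min$. ${\mathcal R}_A$ is a similarity relation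 (reflexive, symmetric, min-transitive map to $[0,1]$) on $\mathcal{F}\cup\mathcal{V}$ with ${\mathcal R}_A(x,y)=0$ for distinct variables, ${\mathcal R}_A(f,g)=0$ for constants of different types, ${\mathcal R}_A(x,f)=0$ for a variable and a constant. It induces ${\mathcal R}$ on terms: on normal forms ${\mathcal R}(a,b)={\mathcal R}_A(a,b)$ for symbols, ${\mathcal R}((t_1\,s_1),(t_2\,s_2))={\mathcal R}(t_1,t_2)\wedge{\mathcal R}(s_1,s_2)$, ${\mathcal R}(\lambda x.t,\lambda y.s)={\mathcal R}(t\{x\mapsto z\},s\{y\mapsto z\})$ for fresh $z$ of the same type, $0$ otherwise. A cut value is $\mu\in(0,1]$. Write $t\simeq_{{\mathcal R},\mu}s$ iff ${\mathcal R}(t,s)\ge\mu$. For a set of variables $V$, $\sigma\preceq^V_{{\mathcal R},\mu}\vartheta$ iff there is a substitution $\psi$ with $X\sigma\psi\simeq_{{\mathcal R},\mu}X\vartheta$ for all $X\in V$. An equation is written $t\simeq^?_{{\mathcal R},\mu}s$; a unification problem is a finite set of equations. A substitution $\sigma$ is an $({\mathcal R},\mu)$-unifier of $\{t_1\simeq^?_{{\mathcal R},\mu}s_1,\dots,t_n\simeq^?_{{\mathcal R},\mu}s_n\}$ with degree $\mathfrak{d}$ if ${\mathcal R}(t_1\sigma,s_1\sigma)\wedge\dots\wedge{\mathcal R}(t_n\sigma,s_n\sigma)=\mathfrak{d}\ge\mu$; a unifier of $t$ and $s$ is a unifier of $\{t\simeq^?_{{\mathcal R},\mu}s\}$. Algorithm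 $\mathsf{HOPSU}$: it works on configurations $P;\sigma;\mathfrak{d}$ ($P$ a problem, $\sigma$ a substitution, $\mathfrak{d}\ge\mu$ a degree) or $\bot$, applying the following rules to a selected equation as long as possible ($\uplus$ is disjoint union): (Abs) $\{\lambda x.t\simeq^?\lambda x.s\}\uplus P;\sigma;\mathfrak{d}\leadsto\{t\simeq^?s\}\cup P;\sigma;\mathfrak{d}$. (Dec) $\{f(t_1,\dots,t_n)\simeq^?g(s_1,\dots,s_n)\}\uplus P;\sigma;\mathfrak{d}\leadsto\{t_1\simeq^?s_1,\dots,t_n\simeq^?s_n\}\cup P;\sigma;\mathfrak{d}\wedge{\mathcal R}(f,g)$, where $f,g$ are rigid heads, $n\ge0$, and $\mathfrak{d}\wedge{\mathcal R}(f,g)\ge\mu$. (SV) $\{F(x_1,\dots,x_n)\simeq^?F(y_1,\dots,y_n)\}\uplus P;\sigma;\mathfrak{d}\leadsto P\vartheta;\sigma\vartheta;\mathfrak{d}$, where $\{z_1,\dots,z_m\}=\{x_i\mid x_i=y_i\}$ and $\vartheta=\{F\mapsto\lambda x_1,\dots,x_n.H(z_1,\dots,z_m)\}$ with $H$ fresh. (Ori) $\{a(s_1,\dots,s_m)\simeq^?F(x_1,\dots,x_n)\}\uplus P;\sigma;\mathfrak{d}\leadsto\{F(x_1,\dots,x_n)\simeq^?a(s_1,\dots,s_m)\}\cup P;\sigma;\mathfrak{d}$, where $F$ is free and $a$ is a constant or $a\in\{x_1,\dots,x_n\}$. (LF) $\{F(x_1,\dots,x_n)\simeq^?a(s_1,\dots,s_m)\}\uplus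 P;\sigma;\mathfrak{d}\leadsto P\vartheta;\sigma\vartheta;\mathfrak{d}$, where $F\notin\mathtt{fv}(a(s_1,\dots,s_m))$, $a$ is a constant, a free variable, or in $\{x_1,\dots,x_n\}$, $\mathsf{VarElim}(F(x_1,\dots,x_n),a(s_1,\dots,s_m))=\varphi$, and $\vartheta=\varphi|_V$ with $V=\{F\}\cup\mathtt{fv}(a(s_1,\dots,s_m))$. (Fail) $\{t\simeq^?s\}\uplus P;\sigma;\mathfrak{d}\leadsto\bot$ if no other rule applies to the selected equation. $\mathsf{VarElim}(t,s)$ starts from $\{t\simeq^?s\};\varepsilon$ and applies as long as possible: (VE1) $\{F(x_1,\dots,x_n)\simeq^?a(s_1,\dots,s_m)\}\uplus P;\sigma\leadsto\{H_1(x_1,\dots,x_n)\simeq^?s_1,\dots,H_m(x_1,\dots,x_n)\simeq^?s_m\}\cup P;\sigma\vartheta$, where $a$ is a constant or in $\{x_1,\dots,x_n\}$, $\vartheta=\{F\mapsto\lambda x_1,\dots,x_n.a(H_1(x_1,\dots,x_n),\dots,H_m(x_1,\dots,x_n))\}$ with $H_i$ fresh of appropriate types; (VE2) $\{F(x_1,\dots,x_n)\simeq^?G(y_1,\dots,y_m)\}\uplus P;\sigma\leadsto P\vartheta;\sigma\vartheta$, where $\{x_1,\dots,x_n\}\cap\{y_1,\dots,y_m\}=\{z_1,\dots,z_k\}$ and $\vartheta=\{F\mapsto\lambda x_1,\dots,x_n.H(z_1,\dots,z_k),G\mapsto\lambda y_1,\dots,y_m.H(z_1,\dots,z_k)\}$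 with $H$ fresh. If it ends in $\emptyset;\varphi$, then $\mathsf{VarElim}(t,s)=\varphi$.
   Formalization: VarElim is given an extra rule stripping equal leading binders (without it, F ≃? f(λy.a) gets stuck although unifiable), and fresh variables must also avoid Dom(τ) (otherwise σ need not be more general than τ on Dom(τ)). *)

theory Defs
  imports Complex_Main
begin

datatype ty = Base nat | Fun ty ty

(* typed constants and typed free variables: a name together with its type;
   for every type there are countably many of each *)
type_synonym const = "nat \<times> ty"
type_synonym var = "nat \<times> ty"

(* heads: constants, free variables, bound variables (de Bruijn index,
   annotated with the type of the binder it refers to) *)
datatype hd = C const | FV var | BV nat ty

(* a term lambda x1..xn. h(t1,..,tm) is  Lam T1 (... (Lam Tn (Ap h [t1,..,tm]))) ;
   since heads are symbols, every such term is beta-normal *)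
datatype trm = Lam ty trm | Ap hd "trm list"

fun arrows :: "ty list \<Rightarrow> ty \<Rightarrow> ty" where
  "arrows [] U = U"
| "arrows (T # Ts) U = Fun T (arrows Ts U)"

fun argtys :: "ty \<Rightarrow> ty list" where
  "argtys (Base b) = []"
| "argtys (Fun A B) = A # argtys B"

fun resty :: "ty \<Rightarrow> ty" where
  "resty (Base b) = Base b"
| "resty (Fun A B) = resty B"

fun headty :: "hd \<Rightarrow> ty" where
  "headty (C c) = snd c"
| "headty (FV X) = snd X"
| "headty (BV i T) = T"

fun dropty :: "nat \<Rightarrow> ty \<Rightarrow> ty" where
  "dropty 0 T = T"
| "dropty (Suc n) (Fun A B) = dropty n B"
| "dropty (Suc n) (Base b) = Base b"

fun typeof :: "trm \<Rightarrow> ty" where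
  "typeof (Lam T t) = Fun T (typeof t)"
| "typeof (Ap h ts) = dropty (length ts) (headty h)"

(* hopat \<Gamma> t T : t is an eta-long (except arguments of free variables, which are
   eta-normal bound variables) higher-order pattern of type T in the context \<Gamma>
   of binder types (innermost binder first) *)
inductive hopat :: "ty list \<Rightarrow> trm \<Rightarrow> ty \<Rightarrow> bool" where
  pat_lam: "hopat (T # \<Gamma>) t U \<Longrightarrow> hopat \<Gamma> (Lam T t) (Fun T U)"
| pat_const: "\<lbrakk> length ts = length Ts; \<forall>i<length ts. hopat \<Gamma> (ts ! i) (Ts ! i);
               snd c = arrows Ts (Base b) \<rbrakk> \<Longrightarrow> hopat \<Gamma> (Ap (C c) ts) (Base b)"
| pat_bound: "\<lbrakk> i < length \<Gamma>; \<Gamma> ! i = S; S = arrows Ts (Base b);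
               length ts = length Ts; \<forall>k<length ts. hopat \<Gamma> (ts ! k) (Ts ! k) \<rbrakk>
               \<Longrightarrow> hopat \<Gamma> (Ap (BV i S) ts) (Base b)"
| pat_free: "\<lbrakk> distinct (map fst js); \<forall>(j, S) \<in> set js. j < length \<Gamma> \<and> \<Gamma> ! j = S;
              snd X = arrows (map snd js) (Base b) \<rbrakk>
              \<Longrightarrow> hopat \<Gamma> (Ap (FV X) (map (\<lambda>(j, S). Ap (BV j S) []) js)) (Base b)"

fun fvh :: "hd \<Rightarrow> var set" where
  "fvh (FV X) = {X}"
| "fvh (C c) = {}"
| "fvh (BV i T) = {}"

fun fv :: "trm \<Rightarrow> var set" where
  "fv (Lam T t) = fv t"
| "fv (Ap h ts) = fvh h \<union> \<Union> (set (map fv ts))"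

fun renh :: "(nat \<Rightarrow> nat) \<Rightarrow> nat \<Rightarrow> hd \<Rightarrow> hd" where
  "renh f d (BV i T) = (if i < d then BV i T else BV (f (i - d) + d) T)"
| "renh f d (C c) = C c"
| "renh f d (FV X) = FV X"

fun ren :: "(nat \<Rightarrow> nat) \<Rightarrow> nat \<Rightarrow> trm \<Rightarrow> trm" where
  "ren f d (Lam T t) = Lam T (ren f (Suc d) t)"
| "ren f d (Ap h ts) = Ap (renh f d h) (map (ren f d) ts)"

definition lift :: "nat \<Rightarrow> trm \<Rightarrow> trm" where
  "lift k t = ren (\<lambda>i. i + k) 0 t"

fun is_bvatom :: "trm \<Rightarrow> bool" where
  "is_bvatom (Ap (BV i T) []) = True"
| "is_bvatom _ = False"

fun bidx :: "trm \<Rightarrow> nat" where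
  "bidx (Ap (BV i T) []) = i"
| "bidx _ = 0"

fun strip :: "nat \<Rightarrow> trm \<Rightarrow> trm" where
  "strip 0 t = t"
| "strip (Suc n) (Lam T t) = strip n t"
| "strip (Suc n) t = t"

definition mk_abs :: "ty list \<Rightarrow> trm \<Rightarrow> trm" where
  "mk_abs Ts u = foldr Lam Ts u"

(* the bound variables x1..xn of lambda x1..xn (types Ts), seen at depth 0 of the body *)
definition canon :: "ty list \<Rightarrow> trm list" where
  "canon Ts = map (\<lambda>i. Ap (BV (length Ts - 1 - i) (Ts ! i)) []) [0..<length Ts]"

type_synonym subst = "var \<Rightarrow> trm"

(* application of a substitution to a pattern followed by beta-normalisation:
   X(y1..yn) with X \<mapsto> lambda x1..xn. u becomes u{x1 \<mapsto> y1,..,xn \<mapsto> yn} *)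
fun sapp :: "subst \<Rightarrow> trm \<Rightarrow> trm" where
  "sapp \<sigma> (Lam T t) = Lam T (sapp \<sigma> t)"
| "sapp \<sigma> (Ap h ts) =
     (case h of
        FV X \<Rightarrow>
          (if (\<forall>t \<in> set ts. is_bvatom t)
           then ren (\<lambda>i. if i < length ts then bidx (ts ! (length ts - 1 - i)) else i - length ts) 0
                    (strip (length ts) (\<sigma> X))
           else Ap h (map (sapp \<sigma>) ts))
      | _ \<Rightarrow> Ap h (map (sapp \<sigma>) ts))"

definition eta_var :: "var \<Rightarrow> trm" where
  "eta_var X = mk_abs (argtys (snd X)) (Ap (FV X) (canon (argtys (snd X))))"

definition eps :: subst where
  "eps = eta_var"

definition Dom :: "subst \<Rightarrow> var set" where
  "Dom \<sigma> = {X. \<sigma> X \<noteq> eta_var X}"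

definition comp :: "subst \<Rightarrow> subst \<Rightarrow> subst" where
  "comp \<sigma> \<theta> = (\<lambda>X. sapp \<theta> (\<sigma> X))"

definition restrict :: "subst \<Rightarrow> var set \<Rightarrow> subst" where
  "restrict \<phi> V = (\<lambda>X. if X \<in> V then \<phi> X else eta_var X)"

definition is_subst :: "subst \<Rightarrow> bool" where
  "is_subst \<sigma> \<longleftrightarrow> finite (Dom \<sigma>) \<and> (\<forall>X. hopat [] (\<sigma> X) (snd X))"

definition similarity :: "(const \<Rightarrow> const \<Rightarrow> real) \<Rightarrow> bool" where
  "similarity Rc \<longleftrightarrow>
     (\<forall>f g. 0 \<le> Rc f g \<and> Rc f g \<le> 1) \<and>
     (\<forall>f. Rc f f = 1) \<and>
     (\<forall>f g. Rc f g = Rc g f) \<and>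
     (\<forall>f g h. min (Rc f g) (Rc g h) \<le> Rc f h) \<and>
     (\<forall>f g. snd f \<noteq> snd g \<longrightarrow> Rc f g = 0)"

fun RA :: "(const \<Rightarrow> const \<Rightarrow> real) \<Rightarrow> hd \<Rightarrow> hd \<Rightarrow> real" where
  "RA Rc (C f) (C g) = Rc f g"
| "RA Rc (FV X) (FV Y) = (if X = Y then 1 else 0)"
| "RA Rc (BV i T) (BV j U) = (if i = j \<and> T = U then 1 else 0)"
| "RA Rc _ _ = 0"

fun Rt :: "(const \<Rightarrow> const \<Rightarrow> real) \<Rightarrow> trm \<Rightarrow> trm \<Rightarrow> real"
and Rl :: "(const \<Rightarrow> const \<Rightarrow> real) \<Rightarrow> trm list \<Rightarrow> trm list \<Rightarrow> real" where
  "Rt Rc (Lam T t) (Lam U s) = (if T = U then Rt Rc t s else 0)"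
| "Rt Rc (Ap h ts) (Ap g ss) = (if length ts = length ss then min (RA Rc h g) (Rl Rc ts ss) else 0)"
| "Rt Rc (Lam T t) (Ap g ss) = 0"
| "Rt Rc (Ap h ts) (Lam U s) = 0"
| "Rl Rc [] [] = 1"
| "Rl Rc (t # ts) (s # ss) = min (Rt Rc t s) (Rl Rc ts ss)"
| "Rl Rc _ _ = 0"

definition more_general :: "(const \<Rightarrow> const \<Rightarrow> real) \<Rightarrow> real \<Rightarrow> var set \<Rightarrow> subst \<Rightarrow> subst \<Rightarrow> bool" where
  "more_general Rc \<mu> V \<sigma> \<theta> \<longleftrightarrow> (\<exists>\<psi>. is_subst \<psi> \<and> (\<forall>X\<in>V. Rt Rc (sapp \<psi> (\<sigma> X)) (\<theta> X) \<ge> \<mu>))"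

definition unifier_deg :: "(const \<Rightarrow> const \<Rightarrow> real) \<Rightarrow> real \<Rightarrow> subst \<Rightarrow> trm \<Rightarrow> trm \<Rightarrow> real \<Rightarrow> bool" where
  "unifier_deg Rc \<mu> \<sigma> t s d \<longleftrightarrow> Rt Rc (sapp \<sigma> t) (sapp \<sigma> s) = d \<and> d \<ge> \<mu>"

type_synonym eqn = "trm \<times> trm"

definition Papp :: "subst \<Rightarrow> eqn set \<Rightarrow> eqn set" where
  "Papp \<theta> P = (\<lambda>(a, b). (sapp \<theta> a, sapp \<theta> b)) ` P"

definition cvars :: "eqn set \<Rightarrow> subst \<Rightarrow> var set" where
  "cvars P \<sigma> = (\<Union>(a, b)\<in>P. fv a \<union> fv b) \<union> Dom \<sigma> \<union> (\<Union>X\<in>Dom \<sigma>. fv (\<sigma> X))"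

fun pos :: "'a list \<Rightarrow> 'a \<Rightarrow> nat" where
  "pos [] a = 0"
| "pos (x # xs) a = (if x = a then 0 else Suc (pos xs a))"

(* lambda x1..xn. u, where xs are the (loose) bound-variable atoms x1..xn
   occurring in u and Ts their types *)
definition abstr :: "ty list \<Rightarrow> trm list \<Rightarrow> trm \<Rightarrow> trm" where
  "abstr Ts xs u = mk_abs Ts (ren (\<lambda>i. length xs - 1 - pos (map bidx xs) i) 0 u)"

(* eta-long form of H(x1,..,xn) of type T (H has type types(xs) \<Rightarrow> T) *)
definition eta_app :: "var \<Rightarrow> trm list \<Rightarrow> ty \<Rightarrow> trm" where
  "eta_app H xs T = mk_abs (argtys T)
     (Ap (FV H) (map (lift (length (argtys T))) xs @ canon (argtys T)))"

definition single :: "var \<Rightarrow> trm \<Rightarrow> subst" where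
  "single F u = (eta_var(F := u))"

definition rigid :: "hd \<Rightarrow> bool" where
  "rigid h \<longleftrightarrow> (\<exists>c. h = C c) \<or> (\<exists>i T. h = BV i T)"

inductive ve_step :: "var set \<Rightarrow> eqn set \<times> subst \<Rightarrow> eqn set \<times> subst \<Rightarrow> bool"
  for A :: "var set" where
  ve_abs: "\<lbrakk> e = (Lam T t, Lam T s); e \<in> Q \<rbrakk>
     \<Longrightarrow> ve_step A (Q, \<phi>) (insert (t, s) (Q - {e}), \<phi>)"
| ve1: "\<lbrakk> e = (Ap (FV F) xs, Ap a ss); e \<in> Q; \<forall>x\<in>set xs. is_bvatom x;
          (\<exists>c. a = C c) \<or> (\<exists>j S. a = BV j S \<and> Ap a [] \<in> set xs);
          length Hs = length ss; distinct Hs;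
          \<forall>H\<in>set Hs. H \<notin> A \<union> cvars Q \<phi>;
          \<forall>i<length ss. snd (Hs ! i) = arrows (map typeof xs) (argtys (headty a) ! i);
          Ts = argtys (snd F);
          \<theta> = single F (abstr Ts xs
                  (Ap a (map (\<lambda>i. eta_app (Hs ! i) xs (argtys (headty a) ! i)) [0..<length ss])));
          Q' = set (map (\<lambda>i. (eta_app (Hs ! i) xs (argtys (headty a) ! i), ss ! i)) [0..<length ss])
               \<union> (Q - {e}) \<rbrakk>
     \<Longrightarrow> ve_step A (Q, \<phi>) (Q', comp \<phi> \<theta>)"
| ve2: "\<lbrakk> e = (Ap (FV F) xs, Ap (FV G) ys); e \<in> Q; F \<noteq> G;
          \<forall>x\<in>set xs. is_bvatom x; \<forall>y\<in>set ys. is_bvatom y;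
          zs = filter (\<lambda>x. x \<in> set ys) xs;
          H \<notin> A \<union> cvars Q \<phi>;
          snd H = arrows (map typeof zs) (resty (snd F));
          \<theta> = (eta_var(F := abstr (argtys (snd F)) xs (Ap (FV H) zs),
                          G := abstr (argtys (snd G)) ys (Ap (FV H) zs))) \<rbrakk>
     \<Longrightarrow> ve_step A (Q, \<phi>) (Papp \<theta> (Q - {e}), comp \<phi> \<theta>)"

definition var_elim :: "var set \<Rightarrow> trm \<Rightarrow> trm \<Rightarrow> subst \<Rightarrow> bool" where
  "var_elim A t s \<phi> \<longleftrightarrow> (ve_step A)\<^sup>*\<^sup>* ({(t, s)}, eps) ({}, \<phi>)"

datatype config = Conf "eqn set" subst real | Bot

(* the non-failing rules applied to the selected equation e, with the remaining problem P;
   W is a set of variables that fresh variables must avoid *)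
inductive hstep0 :: "(const \<Rightarrow> const \<Rightarrow> real) \<Rightarrow> real \<Rightarrow> var set \<Rightarrow> eqn \<Rightarrow> eqn set \<Rightarrow> subst \<Rightarrow> real \<Rightarrow> config \<Rightarrow> bool"
  for Rc :: "const \<Rightarrow> const \<Rightarrow> real" and \<mu> :: real and W :: "var set" where
  Abs: "e = (Lam T t, Lam T s) \<Longrightarrow> hstep0 Rc \<mu> W e P \<sigma> d (Conf (insert (t, s) P) \<sigma> d)"
| Dec: "\<lbrakk> e = (Ap f ts, Ap g ss); rigid f; rigid g; length ts = length ss;
          min d (RA Rc f g) \<ge> \<mu> \<rbrakk>
     \<Longrightarrow> hstep0 Rc \<mu> W e P \<sigma> d (Conf (set (zip ts ss) \<union> P) \<sigma> (min d (RA Rc f g)))"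
| SV: "\<lbrakk> e = (Ap (FV F) xs, Ap (FV F) ys); length xs = length ys;
         \<forall>x\<in>set xs. is_bvatom x; \<forall>y\<in>set ys. is_bvatom y;
         zs = map fst (filter (\<lambda>(x, y). x = y) (zip xs ys));
         H \<notin> W \<union> cvars (insert e P) \<sigma>;
         snd H = arrows (map typeof zs) (resty (snd F));
         \<theta> = single F (abstr (argtys (snd F)) xs (Ap (FV H) zs)) \<rbrakk>
     \<Longrightarrow> hstep0 Rc \<mu> W e P \<sigma> d (Conf (Papp \<theta> P) (comp \<sigma> \<theta>) d)"
| Ori: "\<lbrakk> e = (Ap a ss, Ap (FV F) xs); \<forall>x\<in>set xs. is_bvatom x;
          (\<exists>c. a = C c) \<or> (\<exists>j S. a = BV j S \<and> Ap a [] \<in> set xs) \<rbrakk>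
     \<Longrightarrow> hstep0 Rc \<mu> W e P \<sigma> d (Conf (insert (Ap (FV F) xs, Ap a ss) P) \<sigma> d)"
| LF: "\<lbrakk> e = (Ap (FV F) xs, u); u = Ap a ss; \<forall>x\<in>set xs. is_bvatom x; F \<notin> fv u;
         (\<exists>c. a = C c) \<or> (\<exists>G. a = FV G) \<or> (\<exists>j S. a = BV j S \<and> Ap a [] \<in> set xs);
         var_elim (W \<union> cvars (insert e P) \<sigma>) (Ap (FV F) xs) u \<phi>;
         \<theta> = restrict \<phi> ({F} \<union> fv u) \<rbrakk>
     \<Longrightarrow> hstep0 Rc \<mu> W e P \<sigma> d (Conf (Papp \<theta> P) (comp \<sigma> \<theta>) d)"

inductive hstep :: "(const \<Rightarrow> const \<Rightarrow> real) \<Rightarrow> real \<Rightarrow> var set \<Rightarrow> config \<Rightarrow> config \<Rightarrow> bool"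
  for Rc :: "const \<Rightarrow> const \<Rightarrow> real" and \<mu> :: real and W :: "var set" where
  rule: "\<lbrakk> e \<in> P; hstep0 Rc \<mu> W e (P - {e}) \<sigma> d c' \<rbrakk> \<Longrightarrow> hstep Rc \<mu> W (Conf P \<sigma> d) c'"
| Fail: "\<lbrakk> e \<in> P; \<not> (\<exists>c'. hstep0 Rc \<mu> W e (P - {e}) \<sigma> d c') \<rbrakk> \<Longrightarrow> hstep Rc \<mu> W (Conf P \<sigma> d) Bot"

definition terminates :: "('a \<Rightarrow> 'a \<Rightarrow> bool) \<Rightarrow> 'a \<Rightarrow> bool" where
  "terminates r c \<longleftrightarrow> \<not> (\<exists>f. f 0 = c \<and> (\<forall>i. r (f i) (f (Suc i))))"

definition final :: "('a \<Rightarrow> 'a \<Rightarrow> bool) \<Rightarrow> 'a \<Rightarrow> bool" where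
  "final r c \<longleftrightarrow> \<not> (\<exists>c'. r c c')"

end

theory Submission
  imports Defs
begin

text \<open>
  Fix the degree \<open>d\<close> of the given unifier \<open>\<tau>\<close>. Similarity to degree at least \<open>d\<close> is an
  equivalence relation on terms that preserves the shape of terms and their bound variables and is
  compatible with substitution. Along every run of the algorithm there is a substitution \<open>\<psi>\<close>
  that unifies the remaining problem to degree \<open>d\<close> and for which \<open>\<sigma>\<psi>\<close> agrees with \<open>\<tau>\<close> up to
  degree \<open>d\<close>: each binding \<open>\<theta>\<close> factors \<open>\<psi>\<close> up to similarity as \<open>\<theta>\<psi>'\<close>, where \<open>\<psi>'\<close> sends the
  fresh variables to the appropriate pieces of \<open>\<psi>\<close>. Such a \<open>\<psi>\<close> excludes every failure case (the
  occurs check by comparing sizes), and since similar terms have equal size, the total size of the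
  left-hand sides instantiated by \<open>\<psi>\<close> decreases, which gives termination without counting
  variables. The same argument applies to VarElim.
\<close>

declare split_paired_All [simp del] split_paired_Ex [simp del]

section \<open>Higher-order patterns\<close>

lemma argtys_arrows [simp]: "argtys (arrows Ts U) = Ts @ argtys U"
  by (induction Ts) auto

lemma resty_arrows [simp]: "resty (arrows Ts U) = resty U"
  by (induction Ts) auto

lemma arrows_argtys [simp]: "arrows (argtys T) (resty T) = T"
  by (induction T) auto

lemma argtys_resty [simp]: "argtys (resty T) = []"
  by (induction T) auto

lemma resty_resty [simp]: "resty (resty T) = resty T"
  by (induction T) auto

lemma resty_is_Base: "\<exists>b. resty T = Base b"
  by (induction T) auto

lemma mk_abs_simps [simp]: "mk_abs [] u = u" "mk_abs (T # Ts) u = Lam T (mk_abs Ts u)"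
  by (simp_all add: mk_abs_def)

lemma mk_abs_append: "mk_abs (Ts @ Us) u = mk_abs Ts (mk_abs Us u)"
  by (induction Ts) auto

lemma fv_mk_abs [simp]: "fv (mk_abs Ts u) = fv u"
  by (induction Ts) auto

lemma strip_mk_abs [simp]: "strip (length Ts) (mk_abs Ts u) = u"
  by (induction Ts) auto

lemma rigid_simps [simp]: "rigid (C c)" "rigid (BV i T)" "\<not> rigid (FV X)"
  by (simp_all add: rigid_def)

lemma rigid_or_flex: "rigid h \<or> (\<exists>X. h = FV X)"
  by (cases h) auto

lemma fvh_rigid [simp]: "rigid h \<Longrightarrow> fvh h = {}"
  by (cases h) auto

lemma finite_fv [simp]: "finite (fv t)"
proof (induction t)
  case (Ap h ts)
  then show ?case by (cases h) auto
qed simp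

fun rigid_in :: "ty list \<Rightarrow> hd \<Rightarrow> bool" where
  "rigid_in \<Gamma> (C c) = True"
| "rigid_in \<Gamma> (BV i S) = (i < length \<Gamma> \<and> \<Gamma> ! i = S)"
| "rigid_in \<Gamma> (FV X) = False"

lemma rigid_in_rigid: "rigid_in \<Gamma> h \<Longrightarrow> rigid h"
  by (cases h) auto

definition bvatoms :: "ty list \<Rightarrow> nat list \<Rightarrow> trm list" where
  "bvatoms \<Gamma> ns = map (\<lambda>n. Ap (BV n (\<Gamma> ! n)) []) ns"

abbreviation flex_app :: "ty list \<Rightarrow> var \<Rightarrow> nat list \<Rightarrow> trm" where
  "flex_app \<Gamma> X ns \<equiv> Ap (FV X) (bvatoms \<Gamma> ns)"

definition flex_args :: "ty list \<Rightarrow> var \<Rightarrow> nat list \<Rightarrow> bool" where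
  "flex_args \<Gamma> X ns \<longleftrightarrow>
     distinct ns \<and> set ns \<subseteq> {..<length \<Gamma>} \<and> map ((!) \<Gamma>) ns = argtys (snd X)"

lemma length_bvatoms [simp]: "length (bvatoms \<Gamma> ns) = length ns"
  by (simp add: bvatoms_def)

lemma bvatoms_append [simp]: "bvatoms \<Gamma> (ns @ ms) = bvatoms \<Gamma> ns @ bvatoms \<Gamma> ms"
  by (simp add: bvatoms_def)

lemma is_bvatom_bvatoms [simp]: "x \<in> set (bvatoms \<Gamma> ns) \<Longrightarrow> is_bvatom x"
  by (auto simp: bvatoms_def)

lemma map_bidx_bvatoms [simp]: "map bidx (bvatoms \<Gamma> ns) = ns"
  by (simp add: bvatoms_def map_idI)

lemma map_typeof_bvatoms [simp]: "map typeof (bvatoms \<Gamma> ns) = map ((!) \<Gamma>) ns"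
  by (simp add: bvatoms_def)

lemma mem_bvatoms [simp]: "Ap (BV n S) [] \<in> set (bvatoms \<Gamma> ns) \<longleftrightarrow> n \<in> set ns \<and> S = \<Gamma> ! n"
  by (auto simp: bvatoms_def)

lemma UN_fv_bvatoms [simp]: "(\<Union>x\<in>set (bvatoms \<Gamma> ns). fv x) = {}"
  by (auto simp: bvatoms_def)

lemma flex_args_length: "flex_args \<Gamma> X ns \<Longrightarrow> length ns = length (argtys (snd X))"
  by (metis flex_args_def length_map)

lemma hopat_flexI:
  assumes "flex_args \<Gamma> X ns"
  shows "hopat \<Gamma> (flex_app \<Gamma> X ns) (resty (snd X))"
proof -
  obtain b where b: "resty (snd X) = Base b" using resty_is_Base by blast
  let ?js = "map (\<lambda>n. (n, \<Gamma> ! n)) ns"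
  have "snd X = arrows (map snd ?js) (Base b)"
    using assms b arrows_argtys[of "snd X"] by (simp add: flex_args_def o_def)
  then have "hopat \<Gamma> (Ap (FV X) (map (\<lambda>(j, S). Ap (BV j S) []) ?js)) (Base b)"
    using assms by (intro pat_free) (auto simp: flex_args_def o_def)
  then show ?thesis by (simp add: b bvatoms_def o_def)
qed

lemma hopat_rigidI:
  assumes "rigid_in \<Gamma> h" "list_all2 (hopat \<Gamma>) ts (argtys (headty h))"
  shows "hopat \<Gamma> (Ap h ts) (resty (headty h))"
proof -
  obtain b where b: "resty (headty h) = Base b" using resty_is_Base by blast
  then have "headty h = arrows (argtys (headty h)) (Base b)" by (metis arrows_argtys)
  then show ?thesis
    unfolding b using assms
    by (cases h) (auto simp: list_all2_conv_all_nth intro: pat_const pat_bound)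
qed

lemma hopat_induct [consumes 1, case_names Lam Rigid Flex]:
  assumes "hopat \<Gamma> t T"
    and Lam: "\<And>\<Gamma> S t U. hopat (S # \<Gamma>) t U \<Longrightarrow> P (S # \<Gamma>) t U \<Longrightarrow> P \<Gamma> (Lam S t) (Fun S U)"
    and Rigid: "\<And>\<Gamma> h ts. rigid_in \<Gamma> h \<Longrightarrow> list_all2 (hopat \<Gamma>) ts (argtys (headty h)) \<Longrightarrow>
      (\<And>i. i < length ts \<Longrightarrow> P \<Gamma> (ts ! i) (argtys (headty h) ! i)) \<Longrightarrow>
      P \<Gamma> (Ap h ts) (resty (headty h))"
    and Flex: "\<And>\<Gamma> X ns. flex_args \<Gamma> X ns \<Longrightarrow> P \<Gamma> (flex_app \<Gamma> X ns) (resty (snd X))"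
  shows "P \<Gamma> t T"
  using assms(1)
proof induction
  case (pat_lam S \<Gamma> t U)
  then show ?case by (rule Lam)
next
  case (pat_const ts Ts \<Gamma> c b)
  then show ?case using Rigid[of \<Gamma> "C c" ts] by (simp add: list_all2_conv_all_nth)
next
  case (pat_bound i \<Gamma> S Ts b ts)
  then show ?case using Rigid[of \<Gamma> "BV i S" ts] by (simp add: list_all2_conv_all_nth)
next
  case (pat_free js \<Gamma> X b)
  have "map ((!) \<Gamma>) (map fst js) = map snd js" using pat_free(2) by auto
  then have "flex_args \<Gamma> X (map fst js)"
    using pat_free by (auto simp: flex_args_def simp del: map_map)
  moreover have "map (\<lambda>(j, S). Ap (BV j S) []) js = bvatoms \<Gamma> (map fst js)"
    using pat_free(2) by (auto simp: bvatoms_def)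
  ultimately show ?case using Flex[of \<Gamma> X "map fst js"] pat_free(3) by simp
qed

lemma hopat_untyped_induct [consumes 1, case_names Lam Rigid Flex]:
  assumes "hopat \<Gamma> t T"
    and "\<And>\<Gamma> S t. P (S # \<Gamma>) t \<Longrightarrow> P \<Gamma> (Lam S t)"
    and "\<And>\<Gamma> h ts. rigid_in \<Gamma> h \<Longrightarrow> rigid h \<Longrightarrow> (\<And>t. t \<in> set ts \<Longrightarrow> P \<Gamma> t) \<Longrightarrow> P \<Gamma> (Ap h ts)"
    and "\<And>\<Gamma> X ns. flex_args \<Gamma> X ns \<Longrightarrow> P \<Gamma> (flex_app \<Gamma> X ns)"
  shows "P \<Gamma> t"
  using assms(1)
proof (induction rule: hopat_induct)
  case (Rigid \<Gamma> h ts)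
  then have "P \<Gamma> t" if "t \<in> set ts" for t using that by (auto simp: in_set_conv_nth)
  then show ?case using assms(3) Rigid.hyps(1) rigid_in_rigid by blast
qed (rule assms(2,4); assumption)+

lemma hopat_flex_iff:
  "hopat \<Gamma> (Ap (FV X) ts) T \<longleftrightarrow>
     (\<exists>ns. ts = bvatoms \<Gamma> ns \<and> flex_args \<Gamma> X ns \<and> T = resty (snd X))"
proof
  assume "hopat \<Gamma> (Ap (FV X) ts) T"
  then show "\<exists>ns. ts = bvatoms \<Gamma> ns \<and> flex_args \<Gamma> X ns \<and> T = resty (snd X)"
    by (induction \<Gamma> "Ap (FV X) ts" T rule: hopat_induct) auto
qed (auto intro: hopat_flexI)

lemma hopat_rigid_iff:
  assumes "rigid h"
  shows "hopat \<Gamma> (Ap h ts) T \<longleftrightarrow>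
    rigid_in \<Gamma> h \<and> list_all2 (hopat \<Gamma>) ts (argtys (headty h)) \<and> T = resty (headty h)"
proof
  assume "hopat \<Gamma> (Ap h ts) T"
  then show "rigid_in \<Gamma> h \<and> list_all2 (hopat \<Gamma>) ts (argtys (headty h)) \<and> T = resty (headty h)"
    using assms by (induction \<Gamma> "Ap h ts" T rule: hopat_induct) auto
qed (auto intro: hopat_rigidI)

lemma hopat_Lam_iff: "hopat \<Gamma> (Lam S t) T \<longleftrightarrow> (\<exists>U. T = Fun S U \<and> hopat (S # \<Gamma>) t U)"
  by (auto intro: pat_lam elim: hopat.cases)

lemma hopat_FunE:
  assumes "hopat \<Gamma> t (Fun S U)"
  obtains u where "t = Lam S u" "hopat (S # \<Gamma>) u U"
  using assms by cases auto

lemma hopat_Lam_Lam: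
  assumes "hopat \<Gamma> (Lam S t) T" "hopat \<Gamma> (Lam S s) T"
  shows "\<exists>U. hopat (S # \<Gamma>) t U \<and> hopat (S # \<Gamma>) s U"
  using assms by (auto simp: hopat_Lam_iff)

lemma hopat_pair_cases [consumes 2, case_names Lam Rigid_Rigid Rigid_Flex Flex_Rigid Flex_Flex]:
  assumes "hopat \<Gamma> t T" "hopat \<Gamma> s T"
  obtains S t' s' where "t = Lam S t'" "s = Lam S s'"
  | h ts g ss where "t = Ap h ts" "s = Ap g ss" "rigid h" "rigid g"
  | h ts G ys where "t = Ap h ts" "s = Ap (FV G) ys" "rigid h"
  | F xs g ss where "t = Ap (FV F) xs" "s = Ap g ss" "rigid g"
  | F xs G ys where "t = Ap (FV F) xs" "s = Ap (FV G) ys"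
proof (cases T)
  case (Fun S U)
  then show thesis using assms that(1) by (metis hopat_FunE)
next
  case (Base b)
  then obtain h ts g ss where "t = Ap h ts" "s = Ap g ss"
    using assms by (metis hopat_Lam_iff trm.exhaust ty.simps(4))
  then show thesis using that rigid_or_flex by metis
qed

lemma hopat_mk_abs: "hopat (rev Ts @ \<Gamma>) u U \<Longrightarrow> hopat \<Gamma> (mk_abs Ts u) (arrows Ts U)"
  by (induction Ts arbitrary: \<Gamma>) (auto intro: pat_lam)

lemma hopat_strip:
  assumes "hopat \<Gamma> t T"
  shows "hopat (rev (argtys T) @ \<Gamma>) (strip (length (argtys T)) t) (resty T) \<and>
    mk_abs (argtys T) (strip (length (argtys T)) t) = t"
  using assms
proof (induction T arbitrary: \<Gamma> t rule: ty.induct)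
  case (Fun S U)
  from Fun.prems obtain u where "t = Lam S u" "hopat (S # \<Gamma>) u U" by (rule hopat_FunE)
  with Fun.IH(2) show ?case by auto
qed simp

section \<open>Renaming of bound variables\<close>

abbreviation rename :: "(nat \<Rightarrow> nat) \<Rightarrow> trm \<Rightarrow> trm" where
  "rename f \<equiv> ren f 0"

definition up :: "(nat \<Rightarrow> nat) \<Rightarrow> nat \<Rightarrow> nat" where
  "up f i = (case i of 0 \<Rightarrow> 0 | Suc j \<Rightarrow> Suc (f j))"

lemma up_simps [simp]: "up f 0 = 0" "up f (Suc i) = Suc (f i)"
  by (simp_all add: up_def)

lemma up_comp: "up f \<circ> up g = up (f \<circ> g)"
  by (rule ext) (auto simp: up_def split: nat.splits)

lemma up_id: "up (\<lambda>i. i) = (\<lambda>i. i)"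
  by (rule ext) (auto simp: up_def split: nat.splits)

lemma up_funpow: "(up ^^ k) f i = (if i < k then i else f (i - k) + k)"
proof (induction k arbitrary: i)
  case (Suc k)
  show ?case by (cases i) (auto simp: Suc)
qed simp

lemma inj_on_up: "inj_on f {i. Suc i \<in> N} \<Longrightarrow> inj_on (up f) N"
  by (auto simp: inj_on_def up_def split: nat.splits)

lemma ren_Suc: "ren f (Suc k) t = ren (up f) k t"
proof (induction t arbitrary: k)
  case (Ap h ts)
  have "renh f (Suc k) h = renh (up f) k h"
  proof (cases h)
    case (BV i T)
    consider "i \<le> k" | j where "i = Suc (k + j)" by (metis less_iff_Suc_add not_less)
    then show ?thesis using BV by cases (auto simp: le_less)
  qed auto
  with Ap show ?case by simp
qed simp

lemma rename_Lam [simp]: "rename f (Lam T t) = Lam T (rename (up f) t)"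
  by (simp add: ren_Suc)

declare ren.simps(1) [simp del]

lemma rename_mk_abs: "rename f (mk_abs Ts u) = mk_abs Ts (rename ((up ^^ length Ts) f) u)"
  by (induction Ts arbitrary: f) (auto simp: funpow_swap1)

fun bvarsh :: "hd \<Rightarrow> nat set" where
  "bvarsh (BV i T) = {i}"
| "bvarsh (C c) = {}"
| "bvarsh (FV X) = {}"

fun bvars :: "trm \<Rightarrow> nat set" where
  "bvars (Lam T t) = {i. Suc i \<in> bvars t}"
| "bvars (Ap h ts) = bvarsh h \<union> \<Union> (set (map bvars ts))"

lemma UN_bvars_bvatoms [simp]: "(\<Union>x\<in>set (bvatoms \<Gamma> ns). bvars x) = set ns"
  by (auto simp: bvatoms_def)

lemma bvars_mk_abs: "bvars (mk_abs Ts u) = {i. i + length Ts \<in> bvars u}"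
  by (induction Ts) auto

lemma hopat_bvars: "hopat \<Gamma> t T \<Longrightarrow> bvars t \<subseteq> {..<length \<Gamma>}"
proof (induction rule: hopat_untyped_induct)
  case (Rigid \<Gamma> h ts)
  then have "bvarsh h \<subseteq> {..<length \<Gamma>}" by (cases h) auto
  with Rigid show ?case by auto
qed (auto simp: flex_args_def)

lemma rename_cong: "(\<And>i. i \<in> bvars t \<Longrightarrow> f i = g i) \<Longrightarrow> rename f t = rename g t"
proof (induction t arbitrary: f g)
  case (Lam T t)
  have "up f i = up g i" if "i \<in> bvars t" for i
    using that Lam.prems by (cases i) auto
  then have "rename (up f) t = rename (up g) t" by (rule Lam.IH)
  then show ?case by simp
next
  case (Ap h ts)
  have "renh f 0 h = renh g 0 h" using Ap.prems by (cases h) auto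
  moreover have "rename f t = rename g t" if "t \<in> set ts" for t
    by (rule Ap.IH[OF that]) (use Ap.prems that in auto)
  ultimately show ?case by simp
qed

lemma rename_rename: "rename f (rename g t) = rename (f \<circ> g) t"
proof (induction t arbitrary: f g)
  case (Ap h ts)
  then show ?case by (cases h) auto
qed (simp add: up_comp)

lemma rename_id: "rename (\<lambda>i. i) t = t"
proof (induction t)
  case (Ap h ts)
  then show ?case by (cases h) (auto intro: map_idI)
qed (simp add: up_id)

lemma rename_idI: "(\<And>i. i \<in> bvars t \<Longrightarrow> f i = i) \<Longrightarrow> rename f t = t"
  using rename_cong[of t f "\<lambda>i. i"] rename_id by simp

lemma bvars_rename: "bvars (rename f t) = f ` bvars t"
proof (induction t arbitrary: f)
  case (Lam T t)
  have "Suc i \<in> up f ` bvars t \<longleftrightarrow> i \<in> f ` {i. Suc i \<in> bvars t}" for i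
  proof
    assume "Suc i \<in> up f ` bvars t"
    then obtain k where "k \<in> bvars t" "Suc i = up f k" by auto
    then show "i \<in> f ` {i. Suc i \<in> bvars t}" by (cases k) auto
  qed (metis (mono_tags, lifting) image_iff mem_Collect_eq up_simps(2))
  then show ?case using Lam by simp
next
  case (Ap h ts)
  then show ?case by (cases h) auto
qed

lemma fv_rename [simp]: "fv (rename f t) = fv t"
proof (induction t arbitrary: f)
  case (Ap h ts)
  then show ?case by (cases h) auto
qed simp

lemma rename_flex_app:
  assumes "\<And>n. n \<in> set ns \<Longrightarrow> \<Delta> ! f n = \<Gamma> ! n"
  shows "rename f (flex_app \<Gamma> X ns) = flex_app \<Delta> X (map f ns)"
  using assms by (simp add: bvatoms_def)

lemma hopat_rename:
  assumes "hopat \<Gamma> t T" "\<And>i. i \<in> bvars t \<Longrightarrow> f i < length \<Delta> \<and> \<Delta> ! f i = \<Gamma> ! i" "inj_on f (bvars t)"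
  shows "hopat \<Delta> (rename f t) T"
  using assms
proof (induction arbitrary: f \<Delta> rule: hopat_induct)
  case (Lam \<Gamma> S t U)
  have "hopat (S # \<Delta>) (rename (up f) t) U"
  proof (rule Lam.IH)
    fix i assume "i \<in> bvars t"
    then show "up f i < length (S # \<Delta>) \<and> (S # \<Delta>) ! up f i = (S # \<Gamma>) ! i"
      using Lam.prems(1) by (cases i) auto
  qed (use Lam.prems(2) in \<open>simp add: inj_on_up\<close>)
  then show ?case by (auto intro: pat_lam)
next
  case (Rigid \<Gamma> h ts)
  have "rigid_in \<Delta> (renh f 0 h)" "headty (renh f 0 h) = headty h"
    using Rigid.hyps(1) Rigid.prems(1) by (cases h; auto)+
  moreover have "hopat \<Delta> (rename f (ts ! i)) (argtys (headty h) ! i)" if "i < length ts" for i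
  proof (rule Rigid.IH[OF that])
    have sub: "bvars (ts ! i) \<subseteq> bvars (Ap h ts)" using that by auto
    then show "inj_on f (bvars (ts ! i))" using Rigid.prems(2) inj_on_subset by blast
    show "f j < length \<Delta> \<and> \<Delta> ! f j = \<Gamma> ! j" if "j \<in> bvars (ts ! i)" for j
      using Rigid.prems(1) sub that by blast
  qed
  ultimately show ?case
    using Rigid.hyps(2) hopat_rigidI[of \<Delta> "renh f 0 h" "map (rename f) ts"]
    by (simp add: list_all2_conv_all_nth)
next
  case (Flex \<Gamma> X ns)
  have "flex_args \<Delta> X (map f ns)"
    using Flex by (auto simp: flex_args_def distinct_map o_def cong: map_cong)
  moreover have "rename f (flex_app \<Gamma> X ns) = flex_app \<Delta> X (map f ns)"
    using Flex by (intro rename_flex_app) auto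
  ultimately show ?case using hopat_flexI by metis
qed

section \<open>Application of substitutions\<close>

text \<open>
  \<open>beta_ren ns\<close> is the renaming performed by beta reduction when a body is applied to the bound
  variables \<open>ns\<close>; \<open>abs_ren ns\<close> is the one performed by \<^const>\<open>abstr\<close>. The innermost binder has
  index 0, so argument lists are read backwards.
\<close>

definition beta_ren :: "nat list \<Rightarrow> nat \<Rightarrow> nat" where
  "beta_ren ns i = (if i < length ns then ns ! (length ns - 1 - i) else i - length ns)"

definition abs_ren :: "nat list \<Rightarrow> nat \<Rightarrow> nat" where
  "abs_ren ns i = length ns - 1 - pos ns i"

lemma pos_nth: "distinct xs \<Longrightarrow> i < length xs \<Longrightarrow> pos xs (xs ! i) = i"
  by (induction xs arbitrary: i) (auto simp: nth_Cons split: nat.splits)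

lemma nth_pos: "x \<in> set xs \<Longrightarrow> pos xs x < length xs \<and> xs ! pos xs x = x"
  by (induction xs) auto

lemma abs_ren_beta_ren: "distinct ns \<Longrightarrow> i < length ns \<Longrightarrow> abs_ren ns (beta_ren ns i) = i"
  by (simp add: abs_ren_def beta_ren_def pos_nth)

lemma beta_ren_abs_ren: "n \<in> set ns \<Longrightarrow> beta_ren ns (abs_ren ns n) = n"
  using nth_pos[of n ns] by (auto simp: abs_ren_def beta_ren_def)

lemma beta_ren_mem: "i < length ns \<Longrightarrow> beta_ren ns i \<in> set ns"
  by (simp add: beta_ren_def)

lemma abs_ren_less: "n \<in> set ns \<Longrightarrow> abs_ren ns n < length ns"
  using nth_pos[of n ns] by (auto simp: abs_ren_def)

lemma nth_abs_ren: "n \<in> set ns \<Longrightarrow> rev (map f ns) ! abs_ren ns n = f n"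
  using nth_pos[of n ns] by (auto simp: abs_ren_def rev_nth)

lemma nth_beta_ren: "i < length ns \<Longrightarrow> f (beta_ren ns i) = rev (map f ns) ! i"
  by (simp add: beta_ren_def rev_nth)

lemma map_abs_ren: "distinct ns \<Longrightarrow> map (abs_ren ns) ns = rev [0..<length ns]"
  by (rule nth_equalityI) (simp_all add: abs_ren_def pos_nth rev_nth)

lemma inj_on_beta_ren: "distinct ns \<Longrightarrow> inj_on (beta_ren ns) {..<length ns}"
  by (metis inj_on_inverseI lessThan_iff abs_ren_beta_ren)

lemma inj_on_abs_ren: "inj_on (abs_ren ns) (set ns)"
  by (metis inj_on_inverseI beta_ren_abs_ren)

definition typed_subst :: "subst \<Rightarrow> bool" where
  "typed_subst \<sigma> \<longleftrightarrow> (\<forall>X. hopat [] (\<sigma> X) (snd X))"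

lemma typed_substD: "typed_subst \<sigma> \<Longrightarrow> hopat [] (\<sigma> X) (snd X)"
  by (simp add: typed_subst_def)

definition body :: "subst \<Rightarrow> var \<Rightarrow> trm" where
  "body \<sigma> X = strip (length (argtys (snd X))) (\<sigma> X)"

lemma mk_abs_body: "typed_subst \<sigma> \<Longrightarrow> mk_abs (argtys (snd X)) (body \<sigma> X) = \<sigma> X"
  using hopat_strip[OF typed_substD[of \<sigma> X]] by (simp add: body_def)

lemma hopat_body:
  "typed_subst \<sigma> \<Longrightarrow> hopat (rev (argtys (snd X))) (body \<sigma> X) (resty (snd X))"
  using hopat_strip[OF typed_substD[of \<sigma> X]] by (simp add: body_def)

lemma bvars_body: "typed_subst \<sigma> \<Longrightarrow> bvars (body \<sigma> X) \<subseteq> {..<length (argtys (snd X))}"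
  using hopat_bvars[OF hopat_body] by simp

lemma fv_body: "typed_subst \<sigma> \<Longrightarrow> fv (body \<sigma> X) = fv (\<sigma> X)"
  by (metis fv_mk_abs mk_abs_body)

lemma sapp_rigid [simp]: "rigid h \<Longrightarrow> sapp \<sigma> (Ap h ts) = Ap h (map (sapp \<sigma>) ts)"
  by (cases h) auto

lemma sapp_flex:
  assumes "\<forall>t\<in>set ts. is_bvatom t" "length ts = length (argtys (snd X))"
  shows "sapp \<sigma> (Ap (FV X) ts) = rename (beta_ren (map bidx ts)) (body \<sigma> X)"
proof -
  have "(\<lambda>i. if i < length ts then bidx (ts ! (length ts - 1 - i)) else i - length ts) =
      beta_ren (map bidx ts)"
    by (auto simp: beta_ren_def)
  then show ?thesis using assms by (simp add: body_def del: One_nat_def)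
qed

declare sapp.simps(2) [simp del]

lemma sapp_flex_app:
  "length ns = length (argtys (snd X)) \<Longrightarrow>
   sapp \<sigma> (flex_app \<Gamma> X ns) = rename (beta_ren ns) (body \<sigma> X)"
  by (simp add: sapp_flex)

lemma sapp_mk_abs [simp]: "sapp \<sigma> (mk_abs Ts u) = mk_abs Ts (sapp \<sigma> u)"
  by (induction Ts) auto

lemma bvars_sapp_flex_app:
  assumes "typed_subst \<sigma>" "length ns = length (argtys (snd X))"
  shows "bvars (sapp \<sigma> (flex_app \<Gamma> X ns)) \<subseteq> set ns"
  using bvars_body[OF assms(1), of X]
  by (auto simp: sapp_flex_app assms(2) bvars_rename intro!: beta_ren_mem)

lemma hopat_sapp:
  assumes "hopat \<Gamma> t T" "typed_subst \<sigma>"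
  shows "hopat \<Gamma> (sapp \<sigma> t) T"
  using assms(1)
proof (induction rule: hopat_induct)
  case (Rigid \<Gamma> h ts)
  then have "list_all2 (hopat \<Gamma>) (map (sapp \<sigma>) ts) (argtys (headty h))"
    by (simp add: list_all2_conv_all_nth)
  then show ?case using Rigid.hyps(1) by (simp add: rigid_in_rigid hopat_rigidI)
next
  case (Flex \<Gamma> X ns)
  note len = flex_args_length[OF Flex]
  note bvars = bvars_body[OF assms(2), of X, folded len]
  have ns: "distinct ns" "set ns \<subseteq> {..<length \<Gamma>}" "map ((!) \<Gamma>) ns = argtys (snd X)"
    using Flex by (simp_all add: flex_args_def)
  have "hopat \<Gamma> (rename (beta_ren ns) (body \<sigma> X)) (resty (snd X))"
  proof (rule hopat_rename[OF hopat_body[OF assms(2)]])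
    fix i assume "i \<in> bvars (body \<sigma> X)"
    then have i: "i < length ns" using bvars by auto
    then have "beta_ren ns i < length \<Gamma>" using beta_ren_mem ns(2) by blast
    then show "beta_ren ns i < length \<Gamma> \<and> \<Gamma> ! beta_ren ns i = rev (argtys (snd X)) ! i"
      using nth_beta_ren[OF i, of "(!) \<Gamma>"] ns(3) by simp
  qed (use inj_on_beta_ren[OF ns(1)] bvars inj_on_subset in blast)
  then show ?case by (simp add: sapp_flex_app len)
qed (auto intro: pat_lam)

lemma sapp_rename:
  assumes "hopat \<Gamma> t T" "typed_subst \<sigma>"
  shows "sapp \<sigma> (rename f t) = rename f (sapp \<sigma> t)"
  using assms(1)
proof (induction arbitrary: f rule: hopat_untyped_induct)
  case (Rigid \<Gamma> h ts)
  then have "rigid (renh f 0 h)" by (cases h) auto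
  with Rigid show ?case by simp
next
  case (Flex \<Gamma> X ns)
  note len = flex_args_length[OF Flex]
  have args: "\<forall>x\<in>set (map (rename f) (bvatoms \<Gamma> ns)). is_bvatom x"
    "map bidx (map (rename f) (bvatoms \<Gamma> ns)) = map f ns"
    by (auto simp: bvatoms_def)
  have "sapp \<sigma> (rename f (flex_app \<Gamma> X ns)) = rename (beta_ren (map f ns)) (body \<sigma> X)"
    using sapp_flex[OF args(1)] args(2) len by simp
  also have "\<dots> = rename (f \<circ> beta_ren ns) (body \<sigma> X)"
    using bvars_body[OF assms(2), of X]
    by (intro rename_cong) (auto simp: beta_ren_def simp flip: len)
  finally show ?case by (simp add: sapp_flex_app len rename_rename)
qed auto

lemma sapp_cong:
  assumes "hopat \<Gamma> t T" "\<And>X. X \<in> fv t \<Longrightarrow> \<sigma> X = \<theta> X"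
  shows "sapp \<sigma> t = sapp \<theta> t"
  using assms
proof (induction rule: hopat_untyped_induct)
  case (Rigid \<Gamma> h ts)
  then have "sapp \<sigma> t = sapp \<theta> t" if "t \<in> set ts" for t using that by auto
  with Rigid.hyps show ?case by simp
next
  case (Flex \<Gamma> X ns)
  then have "body \<sigma> X = body \<theta> X" by (simp add: body_def)
  with Flex.hyps show ?case by (simp add: sapp_flex_app flex_args_length)
qed auto

lemma fv_sapp:
  assumes "hopat \<Gamma> t T" "typed_subst \<sigma>"
  shows "fv (sapp \<sigma> t) \<subseteq> (\<Union>X\<in>fv t. fv (\<sigma> X))"
  using assms(1)
proof (induction rule: hopat_untyped_induct)
  case (Flex \<Gamma> X ns)
  then show ?case by (simp add: sapp_flex_app flex_args_length fv_body assms(2))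
qed force+

definition abstract_bvs :: "ty list \<Rightarrow> nat list \<Rightarrow> trm \<Rightarrow> trm" where
  "abstract_bvs \<Gamma> ns u = mk_abs (map ((!) \<Gamma>) ns) (rename (abs_ren ns) u)"

lemma abstr_eq_abstract_bvs:
  "flex_args \<Gamma> X ns \<Longrightarrow> abstr (argtys (snd X)) (bvatoms \<Gamma> ns) u = abstract_bvs \<Gamma> ns u"
  by (simp add: abstr_def abs_ren_def[abs_def] abstract_bvs_def flex_args_def)

lemma fv_abstract_bvs [simp]: "fv (abstract_bvs \<Gamma> ns u) = fv u"
  by (simp add: abstract_bvs_def)

lemma hopat_abstract_bvs:
  assumes "hopat \<Gamma> u U" "bvars u \<subseteq> set ns"
  shows "hopat [] (abstract_bvs \<Gamma> ns u) (arrows (map ((!) \<Gamma>) ns) U)"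
  unfolding abstract_bvs_def
proof (rule hopat_mk_abs, rule hopat_rename[OF assms(1)])
  fix i assume "i \<in> bvars u"
  then have "i \<in> set ns" using assms(2) by auto
  then show "abs_ren ns i < length (rev (map ((!) \<Gamma>) ns) @ []) \<and>
      (rev (map ((!) \<Gamma>) ns) @ []) ! abs_ren ns i = \<Gamma> ! i"
    by (simp add: abs_ren_less nth_abs_ren)
qed (use inj_on_abs_ren assms(2) inj_on_subset in blast)

lemma hopat_abstract_bvs_flex:
  assumes "flex_args \<Gamma> X ns" "hopat \<Gamma> u (resty (snd X))" "bvars u \<subseteq> set ns"
  shows "hopat [] (abstract_bvs \<Gamma> ns u) (snd X)"
  using hopat_abstract_bvs[OF assms(2,3)] assms(1) by (simp add: flex_args_def)

lemma sapp_abstract_bvs: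
  assumes "hopat \<Gamma> u U" "typed_subst \<sigma>"
  shows "sapp \<sigma> (abstract_bvs \<Delta> ns u) = abstract_bvs \<Delta> ns (sapp \<sigma> u)"
  by (simp add: abstract_bvs_def sapp_rename[OF assms])

lemma abstract_bvs_beta:
  assumes "\<sigma> X = abstract_bvs \<Gamma> ns u" "bvars u \<subseteq> set ns" "flex_args \<Gamma> X ns"
  shows "sapp \<sigma> (flex_app \<Gamma> X ns) = u"
proof -
  have "body \<sigma> X = rename (abs_ren ns) u"
    using strip_mk_abs[of "map ((!) \<Gamma>) ns"]
    by (simp add: body_def assms(1) abstract_bvs_def flip: flex_args_length[OF assms(3)])
  then have "sapp \<sigma> (flex_app \<Gamma> X ns) = rename (beta_ren ns \<circ> abs_ren ns) u"
    using assms(3) by (simp add: sapp_flex_app flex_args_length rename_rename)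
  also have "\<dots> = u" using assms(2) by (intro rename_idI) (auto simp: beta_ren_abs_ren)
  finally show ?thesis .
qed

lemma abstract_bvs_eta:
  assumes "typed_subst \<sigma>" "flex_args \<Gamma> X ns"
  shows "abstract_bvs \<Gamma> ns (sapp \<sigma> (flex_app \<Gamma> X ns)) = \<sigma> X"
proof -
  note len = flex_args_length[OF assms(2)]
  have ns: "distinct ns" "map ((!) \<Gamma>) ns = argtys (snd X)"
    using assms(2) by (simp_all add: flex_args_def)
  have "rename (abs_ren ns) (rename (beta_ren ns) (body \<sigma> X)) = body \<sigma> X"
    unfolding rename_rename using bvars_body[OF assms(1), of X] ns(1)
    by (intro rename_idI) (auto simp: abs_ren_beta_ren simp flip: len)
  then show ?thesis
    using mk_abs_body[OF assms(1)] by (simp add: abstract_bvs_def ns(2) sapp_flex_app len)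
qed

subsection \<open>Eta-expanded variables\<close>

text \<open>The arguments of \<open>H\<close> in \<^const>\<open>eta_app\<close>, seen below the \<open>k\<close> binders added by eta expansion.\<close>

definition eta_args :: "nat \<Rightarrow> nat list \<Rightarrow> nat list" where
  "eta_args k ns = map (\<lambda>n. n + k) ns @ rev [0..<k]"

lemma length_eta_args [simp]: "length (eta_args k ns) = length ns + k"
  by (simp add: eta_args_def)

lemma map_nth_eta_args:
  "map ((!) (rev Us @ \<Gamma>)) (eta_args (length Us) ns) = map ((!) \<Gamma>) ns @ Us"
  by (rule nth_equalityI) (auto simp: eta_args_def nth_append rev_nth)

lemma eta_app_bvatoms:
  "eta_app H (bvatoms \<Gamma> ns) T =
     mk_abs (argtys T) (flex_app (rev (argtys T) @ \<Gamma>) H (eta_args (length (argtys T)) ns))"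
proof -
  let ?k = "length (argtys T)" and ?\<Delta> = "rev (argtys T) @ \<Gamma>"
  have "map (lift ?k) (bvatoms \<Gamma> ns) = bvatoms ?\<Delta> (map (\<lambda>n. n + ?k) ns)"
    by (simp add: bvatoms_def lift_def nth_append)
  moreover have "canon (argtys T) = bvatoms ?\<Delta> (rev [0..<?k])"
    by (rule nth_equalityI) (auto simp: canon_def bvatoms_def rev_nth nth_append)
  ultimately show ?thesis by (simp add: eta_app_def eta_args_def)
qed

lemma flex_args_eta_args:
  assumes "distinct ns" "set ns \<subseteq> {..<length \<Gamma>}" "snd H = arrows (map ((!) \<Gamma>) ns) T"
  shows "flex_args (rev (argtys T) @ \<Gamma>) H (eta_args (length (argtys T)) ns)"
  using assms by (auto simp: flex_args_def map_nth_eta_args) (auto simp: eta_args_def distinct_map)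

lemma hopat_eta_app:
  assumes "distinct ns" "set ns \<subseteq> {..<length \<Gamma>}" "snd H = arrows (map ((!) \<Gamma>) ns) T"
  shows "hopat \<Gamma> (eta_app H (bvatoms \<Gamma> ns) T) T"
  using hopat_mk_abs[OF hopat_flexI[OF flex_args_eta_args[OF assms]]] assms(3)
  by (simp add: eta_app_bvatoms)

lemma fv_eta_app [simp]: "fv (eta_app H (bvatoms \<Gamma> ns) T) = {H}"
  by (simp add: eta_app_bvatoms)

lemma bvars_eta_app [simp]: "bvars (eta_app H (bvatoms \<Gamma> ns) T) = set ns"
  by (auto simp: eta_app_bvatoms bvars_mk_abs eta_args_def)

lemma sapp_eta_app:
  assumes "hopat \<Gamma> u T" "bvars u \<subseteq> set ns" "\<sigma> H = abstract_bvs \<Gamma> ns u"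
    and "snd H = arrows (map ((!) \<Gamma>) ns) T"
  shows "sapp \<sigma> (eta_app H (bvatoms \<Gamma> ns) T) = u"
proof -
  let ?k = "length (argtys T)"
  obtain v where v: "u = mk_abs (argtys T) v" using hopat_strip[OF assms(1)] by metis
  have "body \<sigma> H = rename ((up ^^ ?k) (abs_ren ns)) v"
    using strip_mk_abs[of "map ((!) \<Gamma>) ns @ argtys T"] assms(4)
    by (simp add: body_def assms(3) v abstract_bvs_def rename_mk_abs flip: mk_abs_append)
  moreover have "beta_ren (eta_args ?k ns) ((up ^^ ?k) (abs_ren ns) i) = i" if "i \<in> bvars v" for i
  proof (cases "i < ?k")
    case True
    then show ?thesis by (auto simp: up_funpow beta_ren_def eta_args_def nth_append rev_nth)
  next
    case False
    then have "i - ?k \<in> set ns" using assms(2) that v by (auto simp: bvars_mk_abs)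
    from beta_ren_abs_ren[OF this] abs_ren_less[OF this] False show ?thesis
      by (auto simp: up_funpow beta_ren_def eta_args_def nth_append rev_nth)
  qed
  ultimately show ?thesis
    using v assms(4) by (simp add: eta_app_bvatoms sapp_flex_app rename_rename rename_idI)
qed

lemma eta_var_eq_eta_app: "eta_var X = eta_app X (bvatoms \<Gamma> []) (snd X)"
  by (simp add: eta_var_def eta_app_def bvatoms_def)

lemma fv_eta_var [simp]: "fv (eta_var X) = {X}"
  by (simp add: eta_var_eq_eta_app[of _ "[]"])

lemma typed_subst_eps: "typed_subst eps"
  by (simp add: typed_subst_def eps_def eta_var_eq_eta_app[of _ "[]"] hopat_eta_app)

lemma sapp_eta_var:
  assumes "typed_subst \<sigma>"
  shows "sapp \<sigma> (eta_var X) = \<sigma> X"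
proof -
  have closed: "bvars (\<sigma> X) = {}" using hopat_bvars[OF typed_substD[OF assms]] by simp
  have "abstract_bvs [] [] (\<sigma> X) = \<sigma> X"
    unfolding abstract_bvs_def list.map mk_abs_simps by (rule rename_idI) (simp add: closed)
  then show ?thesis
    unfolding eta_var_eq_eta_app[of X "[]"]
    by (intro sapp_eta_app typed_substD[OF assms]) (simp_all add: closed)
qed

lemma eta_var_eq_abstract_bvs:
  assumes "flex_args \<Gamma> X ns"
  shows "eta_var X = abstract_bvs \<Gamma> ns (flex_app \<Gamma> X ns)"
proof -
  have ns: "distinct ns" "map ((!) \<Gamma>) ns = argtys (snd X)"
    using assms by (simp_all add: flex_args_def)
  have "rename (abs_ren ns) (flex_app \<Gamma> X ns) =
      flex_app (rev (argtys (snd X))) X (map (abs_ren ns) ns)"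
    by (rule rename_flex_app) (simp add: nth_abs_ren flip: ns(2))
  also have "map (abs_ren ns) ns = rev [0..<length (argtys (snd X))]"
    using map_abs_ren[OF ns(1)] flex_args_length[OF assms] by simp
  finally show ?thesis
    by (simp add: abstract_bvs_def ns(2) eta_var_eq_eta_app[of X "[]"] eta_app_bvatoms eta_args_def)
qed

lemma sapp_eps:
  assumes "hopat \<Gamma> t T"
  shows "sapp eps t = t"
  using assms
proof (induction rule: hopat_untyped_induct)
  case (Flex \<Gamma> X ns)
  then show ?case
    by (intro abstract_bvs_beta) (simp_all add: eps_def eta_var_eq_abstract_bvs)
qed (auto simp: map_idI)

lemma sapp_ident:
  assumes "hopat \<Gamma> t T" "fv t \<inter> Dom \<theta> = {}"
  shows "sapp \<theta> t = t"
proof -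
  have "sapp \<theta> t = sapp eps t"
    by (rule sapp_cong[OF assms(1)]) (use assms(2) in \<open>auto simp: Dom_def eps_def\<close>)
  then show ?thesis using sapp_eps[OF assms(1)] by simp
qed

subsection \<open>Composition\<close>

lemma sapp_sapp:
  assumes "hopat \<Gamma> t T" "typed_subst \<theta>" "typed_subst \<psi>"
  shows "sapp \<psi> (sapp \<theta> t) = sapp (comp \<theta> \<psi>) t"
  using assms(1)
proof (induction rule: hopat_untyped_induct)
  case (Flex \<Gamma> X ns)
  have "comp \<theta> \<psi> X = mk_abs (argtys (snd X)) (sapp \<psi> (body \<theta> X))"
    unfolding comp_def by (subst mk_abs_body[OF assms(2), symmetric]) simp
  then have "body (comp \<theta> \<psi>) X = sapp \<psi> (body \<theta> X)" by (simp add: body_def)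
  then show ?case
    using Flex
    by (simp add: sapp_flex_app flex_args_length sapp_rename[OF hopat_body[OF assms(2)] assms(3)])
qed auto

lemma typed_subst_comp: "typed_subst \<sigma> \<Longrightarrow> typed_subst \<theta> \<Longrightarrow> typed_subst (comp \<sigma> \<theta>)"
  by (simp add: typed_subst_def comp_def hopat_sapp)

lemma comp_assoc:
  assumes "typed_subst \<phi>" "typed_subst \<theta>" "typed_subst \<psi>"
  shows "comp (comp \<phi> \<theta>) \<psi> = comp \<phi> (comp \<theta> \<psi>)"
proof
  fix X
  show "comp (comp \<phi> \<theta>) \<psi> X = comp \<phi> (comp \<theta> \<psi>) X"
    using sapp_sapp[OF typed_substD[OF assms(1)] assms(2,3)] by (simp add: comp_def)
qed

lemma comp_eps_left: "typed_subst \<theta> \<Longrightarrow> comp eps \<theta> = \<theta>"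
  by (simp add: comp_def eps_def sapp_eta_var)

lemma comp_eps_right: "typed_subst \<sigma> \<Longrightarrow> comp \<sigma> eps = \<sigma>"
  by (simp add: comp_def sapp_eps[OF typed_substD])

lemma Dom_comp_subset: "typed_subst \<theta> \<Longrightarrow> Dom (comp \<sigma> \<theta>) \<subseteq> Dom \<sigma> \<union> Dom \<theta>"
  by (auto simp: Dom_def comp_def sapp_eta_var)

subsection \<open>Substitutions with finite domain\<close>

lemma is_subst_iff: "is_subst \<sigma> \<longleftrightarrow> finite (Dom \<sigma>) \<and> typed_subst \<sigma>"
  by (simp add: is_subst_def typed_subst_def)

lemma is_subst_typed [dest]: "is_subst \<sigma> \<Longrightarrow> typed_subst \<sigma>"
  by (simp add: is_subst_iff)

lemma is_subst_eps: "is_subst eps"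
  using typed_subst_eps by (simp add: is_subst_iff Dom_def eps_def)

lemma is_subst_override_on:
  assumes "is_subst \<sigma>" "finite A" "\<And>X. X \<in> A \<Longrightarrow> hopat [] (\<theta> X) (snd X)"
  shows "is_subst (override_on \<sigma> \<theta> A)"
proof -
  have "Dom (override_on \<sigma> \<theta> A) \<subseteq> Dom \<sigma> \<union> A" by (auto simp: Dom_def override_on_def)
  then have "finite (Dom (override_on \<sigma> \<theta> A))"
    using assms(1,2) by (meson finite_UnI finite_subset is_subst_iff)
  then show ?thesis
    using assms(1,3) by (simp add: is_subst_iff typed_subst_def override_on_def)
qed

lemma is_subst_upd:
  assumes "is_subst \<sigma>" "hopat [] u (snd X)"
  shows "is_subst (\<sigma>(X := u))"
proof -
  have "\<sigma>(X := u) = override_on \<sigma> (\<lambda>_. u) {X}" by (simp add: override_on_def fun_eq_iff)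
  then show ?thesis using is_subst_override_on[OF assms(1), of "{X}" "\<lambda>_. u"] assms(2) by simp
qed

lemma is_subst_single: "hopat [] u (snd X) \<Longrightarrow> is_subst (single X u)"
  using is_subst_upd[OF is_subst_eps] by (simp add: single_def eps_def)

lemma is_subst_comp:
  assumes "is_subst \<sigma>" "is_subst \<theta>"
  shows "is_subst (comp \<sigma> \<theta>)"
  using assms Dom_comp_subset[of \<theta> \<sigma>]
  by (auto simp: is_subst_iff typed_subst_comp intro: finite_subset)

lemma fresh_vars:
  fixes A :: "var set"
  assumes "finite A"
  obtains Hs where "map snd Hs = Ts" "distinct Hs" "set Hs \<inter> A = {}"
proof -
  obtain N where N: "\<forall>n\<in>fst ` A. n < N"
    using finite_nat_set_iff_bounded[of "fst ` A"] assms by auto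
  define Hs where "Hs = zip [N..<N + length Ts] Ts"
  have "fst X \<ge> N" if "X \<in> set Hs" for X
    using that by (force simp: Hs_def in_set_zip)
  then have "set Hs \<inter> A = {}" using N by fastforce
  moreover have "distinct Hs" by (simp add: Hs_def distinct_zipI1)
  moreover have "map snd Hs = Ts" by (simp add: Hs_def)
  ultimately show thesis using that by blast
qed

lemma fresh_var:
  fixes A :: "var set"
  assumes "finite A"
  obtains H where "snd H = T" "H \<notin> A"
proof -
  obtain Hs where "map snd Hs = [T]" "distinct Hs" "set Hs \<inter> A = {}"
    using assms by (rule fresh_vars)
  then show thesis using that by (cases Hs) auto
qed

section \<open>Similarity to a fixed degree\<close>

text \<open>
  The surplus for each argument pays for the orientation flag that the weight of an equation adds
  when an application is decomposed into equations between its arguments.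
\<close>

fun tsize :: "trm \<Rightarrow> nat" where
  "tsize (Lam T t) = Suc (tsize t)"
| "tsize (Ap h ts) = Suc (\<Sum>t\<leftarrow>ts. Suc (tsize t))"

lemma tsize_pos [simp]: "0 < tsize t"
  by (cases t) auto

lemma tsize_rename [simp]: "tsize (rename f t) = tsize t"
proof (induction t arbitrary: f)
  case (Ap h ts)
  then have "map (\<lambda>t. Suc (tsize t)) (map (rename f) ts) = map (\<lambda>t. Suc (tsize t)) ts" by auto
  then show ?case by (metis ren.simps(2) tsize.simps(2))
qed simp

lemma tsize_arg: "t \<in> set ts \<Longrightarrow> tsize t < tsize (Ap h ts)"
  using member_le_sum_list[of "Suc (tsize t)" "map (\<lambda>t. Suc (tsize t)) ts"] by force

lemma tsize_sapp_flex_app: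
  "length ns = length (argtys (snd X)) \<Longrightarrow>
   tsize (sapp \<sigma> (flex_app \<Gamma> X ns)) = tsize (body \<sigma> X)"
  by (simp add: sapp_flex_app)

lemma tsize_body_le:
  assumes "hopat \<Gamma> t T" "X \<in> fv t"
  shows "tsize (body \<sigma> X) \<le> tsize (sapp \<sigma> t)"
  using assms
proof (induction rule: hopat_untyped_induct)
  case (Rigid \<Gamma> h ts)
  then obtain t where t: "t \<in> set ts" "X \<in> fv t" by auto
  then have "tsize (body \<sigma> X) \<le> tsize (sapp \<sigma> t)" by (rule Rigid.IH)
  also have "\<dots> < tsize (Ap h (map (sapp \<sigma>) ts))" using t(1) by (intro tsize_arg) simp
  finally show ?case using Rigid.hyps by simp
next
  case (Flex \<Gamma> Y ns)
  then show ?case by (simp add: tsize_sapp_flex_app flex_args_length)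
qed auto

lemma Rt_le_1:
  assumes "similarity Rc"
  shows "Rt Rc t s \<le> 1" and "Rl Rc ts ss \<le> 1"
  by (induction Rc t s and Rc ts ss rule: Rt_Rl.induct) (auto simp: min_le_iff_disj)

locale similarity_degree =
  fixes Rc :: "const \<Rightarrow> const \<Rightarrow> real" and d :: real
  assumes similarity: "similarity Rc" and d_pos: "0 < d" and d_le_1: "d \<le> 1"
begin

definition sim_head :: "hd \<Rightarrow> hd \<Rightarrow> bool" where
  "sim_head h g \<longleftrightarrow> d \<le> RA Rc h g"

inductive sim :: "trm \<Rightarrow> trm \<Rightarrow> bool" where
  sim_Lam: "sim t s \<Longrightarrow> sim (Lam T t) (Lam T s)"
| sim_Ap: "sim_head h g \<Longrightarrow> list_all2 sim ts ss \<Longrightarrow> sim (Ap h ts) (Ap g ss)"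

lemma sim_simps [simp]:
  "sim (Lam T t) (Lam U s) \<longleftrightarrow> T = U \<and> sim t s"
  "sim (Ap h ts) (Ap g ss) \<longleftrightarrow> sim_head h g \<and> list_all2 sim ts ss"
  "\<not> sim (Lam T t) (Ap g ss)" "\<not> sim (Ap h ts) (Lam U s)"
  by (auto elim: sim.cases intro: sim.intros)

lemma Rl_ge_iff: "d \<le> Rl Rc ts ss \<longleftrightarrow> list_all2 (\<lambda>t s. d \<le> Rt Rc t s) ts ss"
proof (induction ts arbitrary: ss)
  case Nil
  then show ?case using d_pos d_le_1 by (cases ss) auto
next
  case (Cons t ts)
  then show ?case using d_pos by (cases ss) auto
qed

lemma sim_iff_Rt: "sim t s \<longleftrightarrow> d \<le> Rt Rc t s"
proof (induction t arbitrary: s)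
  case (Lam T t)
  then show ?case using d_pos by (cases s) auto
next
  case (Ap h ts)
  show ?case
  proof (cases s)
    case (Ap g ss)
    have "list_all2 sim ts ss \<longleftrightarrow> list_all2 (\<lambda>t s. d \<le> Rt Rc t s) ts ss"
      using Ap.IH by (intro list.rel_cong) auto
    then show ?thesis
      using Ap d_pos by (auto simp: sim_head_def Rl_ge_iff dest: list_all2_lengthD)
  qed (use d_pos in simp)
qed

lemma sim_head_simps [simp]:
  "sim_head (BV i T) g \<longleftrightarrow> g = BV i T" "sim_head g (BV i T) \<longleftrightarrow> g = BV i T"
  "sim_head (FV X) g \<longleftrightarrow> g = FV X" "sim_head g (FV X) \<longleftrightarrow> g = FV X"
  "sim_head (C c) g \<longleftrightarrow> (\<exists>c'. g = C c' \<and> d \<le> Rc c c')"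
  using d_pos d_le_1 by (cases g; auto simp: sim_head_def)+

lemma sim_head_refl [simp]: "sim_head h h"
  using d_le_1 similarity by (cases h) (auto simp: similarity_def)

lemma sim_head_sym: "sim_head h g \<Longrightarrow> sim_head g h"
  using similarity by (cases h) (auto simp: similarity_def)

lemma sim_head_trans:
  assumes "sim_head h g" "sim_head g k"
  shows "sim_head h k"
proof (cases h)
  case (C c)
  with assms obtain c1 c2 where "g = C c1" "k = C c2" "d \<le> Rc c c1" "d \<le> Rc c1 c2" by auto
  moreover have "min (Rc c c1) (Rc c1 c2) \<le> Rc c c2"
    using similarity unfolding similarity_def by blast
  ultimately show ?thesis using C by auto
qed (use assms in auto)

lemma sim_head_headty:
  assumes "sim_head h g"
  shows "headty h = headty g"
proof (cases h)
  case (C c)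
  with assms obtain c1 where "g = C c1" "d \<le> Rc c c1" by auto
  moreover have "snd c \<noteq> snd c1 \<longrightarrow> Rc c c1 = 0" using similarity unfolding similarity_def by blast
  ultimately show ?thesis using C d_pos by auto
qed (use assms in auto)

lemma sim_head_rigid: "sim_head h g \<Longrightarrow> rigid h \<Longrightarrow> rigid g"
  by (cases h) auto

lemma sim_head_bvarsh: "sim_head h g \<Longrightarrow> bvarsh h = bvarsh g"
  by (cases h) auto

lemma sim_head_renh: "sim_head h g \<Longrightarrow> sim_head (renh f k h) (renh f k g)"
  by (cases h) auto

lemma sim_refl [simp]: "sim t t"
  by (induction t) (auto intro: list.rel_refl_strong)

lemma sim_sym: "sim t s \<Longrightarrow> sim s t"
  by (induction rule: sim.induct) (auto simp: sim_head_sym list_all2_conv_all_nth)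

lemma sim_trans: "sim t s \<Longrightarrow> sim s u \<Longrightarrow> sim t u"
proof (induction arbitrary: u rule: sim.induct)
  case (sim_Lam t s T)
  then show ?case by (cases u) auto
next
  case (sim_Ap h g ts ss)
  then obtain k us where u: "u = Ap k us" "sim_head g k" "list_all2 sim ss us" by (cases u) auto
  then have "list_all2 sim ts us" using sim_Ap.IH by (auto simp: list_all2_conv_all_nth)
  with u sim_Ap.hyps show ?case using sim_head_trans by auto
qed

lemma sim_mk_abs [simp]: "sim (mk_abs Ts t) (mk_abs Ts s) \<longleftrightarrow> sim t s"
  by (induction Ts) auto

lemma sim_rename: "sim t s \<Longrightarrow> sim (rename f t) (rename f s)"
  by (induction arbitrary: f rule: sim.induct) (auto simp: sim_head_renh list_all2_conv_all_nth)

lemma sim_abstract_bvs: "sim t s \<Longrightarrow> sim (abstract_bvs \<Gamma> ns t) (abstract_bvs \<Gamma> ns s)"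
  by (simp add: abstract_bvs_def sim_rename)

lemma sim_bvars: "sim t s \<Longrightarrow> bvars t = bvars s"
proof (induction rule: sim.induct)
  case (sim_Ap h g ts ss)
  then have "map bvars ts = map bvars ss"
    by (auto simp: list_all2_conv_all_nth intro!: nth_equalityI)
  then show ?case using sim_head_bvarsh[OF sim_Ap.hyps(1)] by (metis bvars.simps(2))
qed simp

lemma sim_tsize: "sim t s \<Longrightarrow> tsize t = tsize s"
proof (induction rule: sim.induct)
  case (sim_Ap h g ts ss)
  then have "map (\<lambda>t. Suc (tsize t)) ts = map (\<lambda>t. Suc (tsize t)) ss"
    by (auto simp: list_all2_conv_all_nth intro!: nth_equalityI)
  then show ?case by (metis tsize.simps(2))
qed simp

lemma sim_rename_rename_eq: "sim (rename f t) (rename g t) \<Longrightarrow> i \<in> bvars t \<Longrightarrow> f i = g i"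
proof (induction t arbitrary: f g i)
  case (Lam T t)
  then have "up f (Suc i) = up g (Suc i)" by (intro Lam.IH) auto
  then show ?case by simp
next
  case (Ap h ts)
  from Ap.prems(2) consider (head) "i \<in> bvarsh h" | (arg) t where "t \<in> set ts" "i \<in> bvars t" by auto
  then show ?case
  proof cases
    case head
    then show ?thesis using Ap.prems(1) by (cases h) auto
  next
    case arg
    then have "sim (rename f t) (rename g t)"
      using Ap.prems(1) by (auto simp: list_all2_conv_all_nth in_set_conv_nth)
    then show ?thesis using arg Ap.IH by blast
  qed
qed

definition sim_on :: "var set \<Rightarrow> subst \<Rightarrow> subst \<Rightarrow> bool" where
  "sim_on S \<sigma> \<theta> \<longleftrightarrow> (\<forall>X\<in>S. sim (\<sigma> X) (\<theta> X))"

lemma sim_on_refl [simp]: "sim_on S \<sigma> \<sigma>"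
  by (simp add: sim_on_def)

lemma sim_on_trans: "sim_on S \<sigma> \<theta> \<Longrightarrow> sim_on S \<theta> \<psi> \<Longrightarrow> sim_on S \<sigma> \<psi>"
  using sim_trans by (auto simp: sim_on_def)

lemma sim_on_subset: "sim_on S \<sigma> \<theta> \<Longrightarrow> S' \<subseteq> S \<Longrightarrow> sim_on S' \<sigma> \<theta>"
  by (auto simp: sim_on_def)

lemma sim_sapp:
  assumes "hopat \<Gamma> t T" "sim_on (fv t) \<sigma> \<theta>" "typed_subst \<sigma>" "typed_subst \<theta>"
  shows "sim (sapp \<sigma> t) (sapp \<theta> t)"
  using assms(1,2)
proof (induction rule: hopat_untyped_induct)
  case (Rigid \<Gamma> h ts)
  have "sim (sapp \<sigma> t) (sapp \<theta> t)" if "t \<in> set ts" for t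
    using Rigid.IH[OF that] Rigid.prems that by (auto simp: sim_on_def)
  with Rigid.hyps show ?case by (simp add: list_all2_conv_all_nth)
next
  case (Flex \<Gamma> X ns)
  have "sim (body \<sigma> X) (body \<theta> X)"
    using Flex.prems mk_abs_body[OF assms(3), of X] mk_abs_body[OF assms(4), of X]
    by (metis UnI1 fv.simps(2) fvh.simps(1) insertI1 sim_mk_abs sim_on_def)
  then show ?case using Flex.hyps by (simp add: sapp_flex_app flex_args_length sim_rename)
qed auto

lemma sim_sapp_factor:
  assumes "hopat \<Gamma> t T" "fv t \<subseteq> S" "sim_on S (comp \<theta> \<psi>') \<psi>"
    and "is_subst \<theta>" "is_subst \<psi>'" "is_subst \<psi>"
  shows "sim (sapp \<psi>' (sapp \<theta> t)) (sapp \<psi> t)"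
proof -
  have "sim (sapp (comp \<theta> \<psi>') t) (sapp \<psi> t)"
    by (rule sim_sapp[OF assms(1) sim_on_subset[OF assms(3,2)]])
      (use assms(4-6) in \<open>simp_all add: is_subst_typed typed_subst_comp\<close>)
  then show ?thesis using assms(4,5) by (simp add: sapp_sapp[OF assms(1)] is_subst_typed)
qed

lemma sim_on_comp:
  assumes "sim_on S \<theta> \<psi>" "\<And>X. X \<in> A \<Longrightarrow> fv (\<phi> X) \<subseteq> S"
    and "typed_subst \<phi>" "typed_subst \<theta>" "typed_subst \<psi>"
  shows "sim_on A (comp \<phi> \<theta>) (comp \<phi> \<psi>)"
  unfolding sim_on_def
proof
  fix X assume "X \<in> A"
  then have "sim_on (fv (\<phi> X)) \<theta> \<psi>" using sim_on_subset[OF assms(1)] assms(2) by blast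
  then show "sim (comp \<phi> \<theta> X) (comp \<phi> \<psi> X)"
    unfolding comp_def using sim_sapp[OF typed_substD[OF assms(3)]] assms(4,5) by blast
qed

lemma more_general_iff:
  "more_general Rc d S \<sigma> \<theta> \<longleftrightarrow> (\<exists>\<psi>. is_subst \<psi> \<and> sim_on S (comp \<sigma> \<psi>) \<theta>)"
  by (simp add: more_general_def sim_on_def comp_def sim_iff_Rt)

end

lemma more_general_mono:
  "more_general Rc \<nu> W \<sigma> \<theta> \<Longrightarrow> \<mu> \<le> \<nu> \<Longrightarrow> V \<subseteq> W \<Longrightarrow> more_general Rc \<mu> V \<sigma> \<theta>"
  unfolding more_general_def by (meson order_trans subsetD)

section \<open>Bindings of free variables\<close>

text \<open>
  Every \<open>F \<in> D\<close>, applied to \<open>arg F\<close>, is bound to \<open>H(ks)\<close>: rule SV is the case \<open>D = {F}\<close>, rule VE2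
  the case \<open>D = {F, G}\<close>.
\<close>

definition prunes :: "ty list \<Rightarrow> (var \<Rightarrow> nat list) \<Rightarrow> var set \<Rightarrow> var \<Rightarrow> nat list \<Rightarrow> bool" where
  "prunes \<Gamma> arg D H ks \<longleftrightarrow> finite D \<and> flex_args \<Gamma> H ks \<and>
     (\<forall>F\<in>D. flex_args \<Gamma> F (arg F) \<and> set ks \<subseteq> set (arg F) \<and> resty (snd F) = resty (snd H))"

definition prune_subst :: "ty list \<Rightarrow> (var \<Rightarrow> nat list) \<Rightarrow> var set \<Rightarrow> var \<Rightarrow> nat list \<Rightarrow> subst" where
  "prune_subst \<Gamma> arg D H ks =
     override_on eps (\<lambda>F. abstract_bvs \<Gamma> (arg F) (flex_app \<Gamma> H ks)) D"

lemma is_subst_prune_subst: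
  assumes "prunes \<Gamma> arg D H ks"
  shows "is_subst (prune_subst \<Gamma> arg D H ks)"
  unfolding prune_subst_def
proof (rule is_subst_override_on[OF is_subst_eps])
  fix F assume "F \<in> D"
  then have F: "flex_args \<Gamma> F (arg F)" "set ks \<subseteq> set (arg F)" "resty (snd F) = resty (snd H)"
    using assms by (auto simp: prunes_def)
  have "hopat \<Gamma> (flex_app \<Gamma> H ks) (resty (snd F))"
    using assms F(3) hopat_flexI by (simp add: prunes_def)
  then show "hopat [] (abstract_bvs \<Gamma> (arg F) (flex_app \<Gamma> H ks)) (snd F)"
    using F by (intro hopat_abstract_bvs_flex) auto
qed (use assms in \<open>simp add: prunes_def\<close>)

lemma Dom_prune_subst: "Dom (prune_subst \<Gamma> arg D H ks) \<subseteq> D"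
  by (auto simp: Dom_def prune_subst_def override_on_def eps_def)

lemma fv_prune_subst: "fv (prune_subst \<Gamma> arg D H ks X) \<subseteq> {X, H}"
  by (auto simp: prune_subst_def override_on_def eps_def)

definition eta_apps :: "var list \<Rightarrow> trm list \<Rightarrow> ty list \<Rightarrow> trm list" where
  "eta_apps Hs xs Ts = map2 (\<lambda>H T. eta_app H xs T) Hs Ts"

lemma length_eta_apps [simp]: "length (eta_apps Hs xs Ts) = min (length Hs) (length Ts)"
  by (simp add: eta_apps_def)

lemma nth_eta_apps [simp]:
  "i < length Hs \<Longrightarrow> i < length Ts \<Longrightarrow> eta_apps Hs xs Ts ! i = eta_app (Hs ! i) xs (Ts ! i)"
  by (simp add: eta_apps_def)

lemma UN_bvars_eta_apps: "(\<Union>x\<in>set (eta_apps Hs (bvatoms \<Gamma> ns) Ts). bvars x) \<subseteq> set ns"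
  by (auto simp: eta_apps_def)

definition imitable :: "hd \<Rightarrow> trm list \<Rightarrow> bool" where
  "imitable a xs \<longleftrightarrow> (\<exists>c. a = C c) \<or> (\<exists>j S. a = BV j S \<and> Ap a [] \<in> set xs)"

lemma imitable_rigid: "imitable a xs \<Longrightarrow> rigid a"
  by (auto simp: imitable_def)

definition imitates :: "ty list \<Rightarrow> var \<Rightarrow> nat list \<Rightarrow> hd \<Rightarrow> var list \<Rightarrow> bool" where
  "imitates \<Gamma> F ns a Hs \<longleftrightarrow> flex_args \<Gamma> F ns \<and> rigid_in \<Gamma> a \<and> imitable a (bvatoms \<Gamma> ns) \<and>
     resty (headty a) = resty (snd F) \<and> distinct Hs \<and>
     list_all2 (\<lambda>H T. snd H = arrows (map ((!) \<Gamma>) ns) T) Hs (argtys (headty a))"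

abbreviation imitation_args :: "ty list \<Rightarrow> nat list \<Rightarrow> hd \<Rightarrow> var list \<Rightarrow> trm list" where
  "imitation_args \<Gamma> ns a Hs \<equiv> eta_apps Hs (bvatoms \<Gamma> ns) (argtys (headty a))"

definition imitation :: "ty list \<Rightarrow> nat list \<Rightarrow> hd \<Rightarrow> var list \<Rightarrow> trm" where
  "imitation \<Gamma> ns a Hs = Ap a (imitation_args \<Gamma> ns a Hs)"

abbreviation imitation_subst :: "ty list \<Rightarrow> var \<Rightarrow> nat list \<Rightarrow> hd \<Rightarrow> var list \<Rightarrow> subst" where
  "imitation_subst \<Gamma> F ns a Hs \<equiv> single F (abstract_bvs \<Gamma> ns (imitation \<Gamma> ns a Hs))"

lemma fresh_imitation:
  assumes "flex_args \<Gamma> F ns" "rigid_in \<Gamma> a" "imitable a (bvatoms \<Gamma> ns)"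
    and "resty (headty a) = resty (snd F)" "finite A"
  obtains Hs where "imitates \<Gamma> F ns a Hs" "set Hs \<inter> A = {}"
proof -
  obtain Hs where Hs: "map snd Hs = map (arrows (map ((!) \<Gamma>) ns)) (argtys (headty a))"
    "distinct Hs" "set Hs \<inter> A = {}"
    using assms(5) by (rule fresh_vars)
  have "list_all2 (\<lambda>H T. snd H = arrows (map ((!) \<Gamma>) ns) T) Hs (argtys (headty a))"
    using Hs(1) unfolding list_all2_conv_all_nth by (metis length_map nth_map)
  then show thesis using that assms(1-4) Hs(2,3) by (simp add: imitates_def)
qed

lemma imitates_length: "imitates \<Gamma> F ns a Hs \<Longrightarrow> length Hs = length (argtys (headty a))"
  by (auto simp: imitates_def dest: list_all2_lengthD)

lemma hopat_imitation_args:
  assumes "imitates \<Gamma> F ns a Hs"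
  shows "list_all2 (hopat \<Gamma>) (imitation_args \<Gamma> ns a Hs) (argtys (headty a))"
  using assms
  by (auto simp: imitates_def flex_args_def list_all2_conv_all_nth intro!: hopat_eta_app)

lemma hopat_imitation:
  assumes "imitates \<Gamma> F ns a Hs"
  shows "hopat \<Gamma> (imitation \<Gamma> ns a Hs) (resty (snd F))"
  using hopat_rigidI[OF _ hopat_imitation_args[OF assms]] assms
  by (simp add: imitation_def imitates_def)

lemma bvars_imitation:
  assumes "imitates \<Gamma> F ns a Hs"
  shows "bvars (imitation \<Gamma> ns a Hs) \<subseteq> set ns"
proof -
  have "bvarsh a \<subseteq> set ns" using assms by (auto simp: imitates_def imitable_def)
  then show ?thesis using UN_bvars_eta_apps by (simp add: imitation_def)
qed

lemma is_subst_imitation_subst: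
  assumes "imitates \<Gamma> F ns a Hs"
  shows "is_subst (imitation_subst \<Gamma> F ns a Hs)"
proof -
  have "flex_args \<Gamma> F ns" using assms by (simp add: imitates_def)
  then show ?thesis
    by (rule is_subst_single[OF hopat_abstract_bvs_flex[OF _ hopat_imitation[OF assms]
        bvars_imitation[OF assms]]])
qed

lemma Dom_single: "Dom (single F u) \<subseteq> {F}"
  by (auto simp: Dom_def single_def)

definition agreeing :: "'a list \<Rightarrow> 'a list \<Rightarrow> 'a list" where
  "agreeing xs ys = map fst (filter (\<lambda>(x, y). x = y) (zip xs ys))"

lemma agreeing_bvatoms: "agreeing (bvatoms \<Gamma> ns) (bvatoms \<Gamma> ms) = bvatoms \<Gamma> (agreeing ns ms)"
  by (auto simp: agreeing_def bvatoms_def zip_map_map filter_map o_def split_beta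
      intro!: arg_cong[where f = "map _"] filter_cong)

lemma set_agreeing_subset: "set (agreeing xs ys) \<subseteq> set xs"
  by (auto simp: agreeing_def dest: set_zip_leftD)

lemma distinct_agreeing: "distinct xs \<Longrightarrow> length xs = length ys \<Longrightarrow> distinct (agreeing xs ys)"
  unfolding agreeing_def by (rule distinct_map_filter) simp

lemma nth_mem_agreeing:
  "i < length xs \<Longrightarrow> length xs = length ys \<Longrightarrow> xs ! i = ys ! i \<Longrightarrow> xs ! i \<in> set (agreeing xs ys)"
  by (force simp: agreeing_def in_set_zip)

lemma filter_bvatoms:
  "filter (\<lambda>x. x \<in> set (bvatoms \<Gamma> ms)) (bvatoms \<Gamma> ns) = bvatoms \<Gamma> (filter (\<lambda>n. n \<in> set ms) ns)"
  by (induction ns) (auto simp: bvatoms_def)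

lemma flex_args_sublist:
  assumes "flex_args \<Gamma> F ns" "distinct ks" "set ks \<subseteq> set ns"
    and "snd H = arrows (map typeof (bvatoms \<Gamma> ks)) (resty (snd F))"
  shows "flex_args \<Gamma> H ks" "resty (snd H) = resty (snd F)"
  using assms by (auto simp: flex_args_def)

context similarity_degree
begin

lemma sim_on_comp_bind:
  assumes "typed_subst \<psi>'" "Dom \<theta> \<subseteq> D"
    and "\<And>X. X \<in> D \<Longrightarrow> sim (sapp \<psi>' (\<theta> X)) (\<psi> X)" "\<And>X. X \<in> S \<Longrightarrow> \<psi>' X = \<psi> X"
  shows "sim_on S (comp \<theta> \<psi>') \<psi>"
  unfolding sim_on_def
proof
  fix X assume "X \<in> S"
  show "sim (comp \<theta> \<psi>' X) (\<psi> X)"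
  proof (cases "X \<in> D")
    case True
    then show ?thesis using assms(3) by (simp add: comp_def)
  next
    case False
    then have "\<theta> X = eta_var X" using assms(2) unfolding Dom_def by blast
    then have "comp \<theta> \<psi>' X = \<psi>' X" using assms(1) by (simp add: comp_def sapp_eta_var)
    then show ?thesis using assms(4) \<open>X \<in> S\<close> by simp
  qed
qed

lemma more_general_prune_subst:
  assumes prunes: "prunes \<Gamma> arg D H ks" and "is_subst \<psi>" "H \<notin> S"
    and w: "hopat \<Gamma> w (resty (snd H))" "bvars w \<subseteq> set ks"
    and sim: "\<And>F. F \<in> D \<Longrightarrow> sim w (sapp \<psi> (flex_app \<Gamma> F (arg F)))"
  shows "more_general Rc d S (prune_subst \<Gamma> arg D H ks) \<psi>"
proof -
  let ?\<theta> = "prune_subst \<Gamma> arg D H ks"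
  define \<psi>' where "\<psi>' = \<psi>(H := abstract_bvs \<Gamma> ks w)"
  have H: "flex_args \<Gamma> H ks" using prunes by (simp add: prunes_def)
  have subst: "is_subst \<psi>'"
    unfolding \<psi>'_def by (rule is_subst_upd[OF assms(2) hopat_abstract_bvs_flex[OF H w]])
  have "sapp \<psi>' (flex_app \<Gamma> H ks) = w" by (rule abstract_bvs_beta[OF _ w(2) H]) (simp add: \<psi>'_def)
  then have "sapp \<psi>' (?\<theta> F) = abstract_bvs \<Gamma> (arg F) w" if "F \<in> D" for F
    using that sapp_abstract_bvs[OF hopat_flexI[OF H] is_subst_typed[OF subst]]
    by (simp add: prune_subst_def override_on_def)
  moreover have "abstract_bvs \<Gamma> (arg F) (sapp \<psi> (flex_app \<Gamma> F (arg F))) = \<psi> F" if "F \<in> D" for F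
    using that prunes assms(2) by (intro abstract_bvs_eta) (auto simp: prunes_def)
  ultimately have "sim (sapp \<psi>' (?\<theta> F)) (\<psi> F)" if "F \<in> D" for F
    using that sim_abstract_bvs[OF sim[OF that]] by metis
  then have "sim_on S (comp ?\<theta> \<psi>') \<psi>"
    using assms(3) subst by (intro sim_on_comp_bind[OF _ Dom_prune_subst]) (auto simp: \<psi>'_def)
  then show ?thesis using subst more_general_iff by blast
qed

lemma bvars_sapp_agreeing:
  assumes "typed_subst \<psi>" "length ns = length (argtys (snd F))"
    "length ms = length (argtys (snd F))"
    and "sim (sapp \<psi> (flex_app \<Gamma> F ns)) (sapp \<psi> (flex_app \<Gamma> F ms))"
  shows "bvars (sapp \<psi> (flex_app \<Gamma> F ns)) \<subseteq> set (agreeing ns ms)"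
proof -
  have "beta_ren ns i \<in> set (agreeing ns ms)" if i: "i \<in> bvars (body \<psi> F)" for i
  proof -
    have "i < length ns" using bvars_body[OF assms(1), of F] i assms(2) by auto
    moreover have "beta_ren ns i = beta_ren ms i"
      using sim_rename_rename_eq[OF _ i] assms(2-4) by (simp add: sapp_flex_app)
    ultimately show ?thesis
      using nth_mem_agreeing[of "length ns - 1 - i" ns ms] assms(2,3) by (simp add: beta_ren_def)
  qed
  then show ?thesis using assms(2) by (auto simp: sapp_flex_app bvars_rename)
qed

lemma imitable_of_sim:
  assumes "flex_args \<Gamma> F ns" "hopat \<Gamma> (Ap a ss) T" "rigid a" "typed_subst \<psi>"
    and "sim (sapp \<psi> (flex_app \<Gamma> F ns)) (sapp \<psi> (Ap a ss))"
  shows "imitable a (bvatoms \<Gamma> ns)"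
proof (cases a)
  case (BV j S)
  have "j \<in> bvars (sapp \<psi> (Ap a ss))" using BV by simp
  then have "j \<in> set ns"
    using sim_bvars[OF assms(5)] bvars_sapp_flex_app[OF assms(4)] assms(1) flex_args_length by blast
  moreover have "\<Gamma> ! j = S" using assms(2,3) BV by (simp add: hopat_rigid_iff)
  ultimately show ?thesis using BV by (auto simp: imitable_def)
qed (use assms(3) in \<open>auto simp: imitable_def\<close>)

lemma occurs_check_of_sim:
  assumes "flex_args \<Gamma> F ns" "hopat \<Gamma> (Ap a ss) T" "rigid a"
    and "sim (sapp \<psi> (flex_app \<Gamma> F ns)) (sapp \<psi> (Ap a ss))"
  shows "F \<notin> fv (Ap a ss)"
proof
  assume "F \<in> fv (Ap a ss)"
  then obtain s where s: "s \<in> set ss" "F \<in> fv s" using assms(3) by auto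
  then obtain U where "hopat \<Gamma> s U"
    using assms(2,3) by (auto simp: hopat_rigid_iff list_all2_conv_all_nth in_set_conv_nth)
  then have "tsize (body \<psi> F) \<le> tsize (sapp \<psi> s)" using s(2) by (rule tsize_body_le)
  also have "\<dots> < tsize (sapp \<psi> (Ap a ss))"
    using s(1) assms(3) tsize_arg[of "sapp \<psi> s" "map (sapp \<psi>) ss" a] by simp
  also have "\<dots> = tsize (body \<psi> F)"
    using sim_tsize[OF assms(4)] tsize_sapp_flex_app[OF flex_args_length[OF assms(1)]] by simp
  finally show False by simp
qed

lemma sim_rigid_instanceE:
  assumes "flex_args \<Gamma> F ns" "resty (headty a) = resty (snd F)" "rigid a" "is_subst \<psi>"
    and "sim (sapp \<psi> (flex_app \<Gamma> F ns)) (sapp \<psi> (Ap a ss))"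
  obtains a' us where "sapp \<psi> (flex_app \<Gamma> F ns) = Ap a' us" "sim_head a' a"
    "list_all2 sim us (map (sapp \<psi>) ss)" "list_all2 (hopat \<Gamma>) us (argtys (headty a))"
    "\<And>u. u \<in> set us \<Longrightarrow> bvars u \<subseteq> set ns"
proof -
  obtain a' us where us: "sapp \<psi> (flex_app \<Gamma> F ns) = Ap a' us" "sim_head a' a"
    "list_all2 sim us (map (sapp \<psi>) ss)"
    using assms(3,5) by (cases "sapp \<psi> (flex_app \<Gamma> F ns)") auto
  have "rigid a'" using sim_head_rigid[OF sim_head_sym[OF us(2)] assms(3)] .
  moreover have "hopat \<Gamma> (Ap a' us) (resty (snd F))"
    using hopat_sapp[OF hopat_flexI[OF assms(1)] is_subst_typed[OF assms(4)]] us(1) by simp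
  ultimately have "list_all2 (hopat \<Gamma>) us (argtys (headty a))"
    using sim_head_headty[OF us(2)] by (simp add: hopat_rigid_iff)
  moreover have "bvars (Ap a' us) \<subseteq> set ns"
    using bvars_sapp_flex_app[OF is_subst_typed[OF assms(4)] flex_args_length[OF assms(1)]] us(1)
    by metis
  ultimately show thesis using us that by auto
qed

lemma instantiate_eta_apps:
  assumes "imitates \<Gamma> F ns a Hs" "is_subst \<psi>"
    and us: "list_all2 (hopat \<Gamma>) us (argtys (headty a))" "\<And>u. u \<in> set us \<Longrightarrow> bvars u \<subseteq> set ns"
  obtains \<psi>' where "is_subst \<psi>'" "\<And>X. X \<notin> set Hs \<Longrightarrow> \<psi>' X = \<psi> X"
    "map (sapp \<psi>') (imitation_args \<Gamma> ns a Hs) = us"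
proof -
  let ?Ts = "argtys (headty a)"
  have len: "length Hs = length ?Ts" "length us = length ?Ts"
    using imitates_length[OF assms(1)] us(1) by (auto dest: list_all2_lengthD)
  have Hs: "distinct Hs" "\<And>i. i < length ?Ts \<Longrightarrow> snd (Hs ! i) = arrows (map ((!) \<Gamma>) ns) (?Ts ! i)"
    using assms(1) by (auto simp: imitates_def list_all2_conv_all_nth)
  have us_nth: "hopat \<Gamma> (us ! i) (?Ts ! i)" "bvars (us ! i) \<subseteq> set ns" if "i < length ?Ts" for i
    using that us len by (auto simp: list_all2_conv_all_nth)
  define g where "g X = abstract_bvs \<Gamma> ns (the (map_of (zip Hs us) X))" for X
  have g_nth: "g (Hs ! i) = abstract_bvs \<Gamma> ns (us ! i)" if "i < length ?Ts" for i
    using that Hs(1) len by (simp add: g_def map_of_zip_nth)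
  show thesis
  proof
    show "is_subst (override_on \<psi> g (set Hs))"
    proof (rule is_subst_override_on[OF assms(2)])
      fix X assume "X \<in> set Hs"
      then obtain i where i: "i < length ?Ts" "X = Hs ! i" using len by (auto simp: in_set_conv_nth)
      then show "hopat [] (g X) (snd X)"
        using hopat_abstract_bvs[OF us_nth] Hs(2) g_nth by simp
    qed simp
    show "map (sapp (override_on \<psi> g (set Hs))) (eta_apps Hs (bvatoms \<Gamma> ns) ?Ts) = us"
      using len us_nth(1) us_nth(2)[THEN subsetD] Hs(2) g_nth
      by (auto intro!: nth_equalityI sapp_eta_app)
  qed simp
qed

lemma imitation_unifierE:
  assumes im: "imitates \<Gamma> F ns a Hs" and "is_subst \<psi>" "set Hs \<inter> S = {}"
    and sim: "sim (sapp \<psi> (flex_app \<Gamma> F ns)) (sapp \<psi> (Ap a ss))"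
  obtains \<psi>' us where "is_subst \<psi>'" "\<And>X. X \<in> S \<Longrightarrow> \<psi>' X = \<psi> X"
    "sim_on S (comp (imitation_subst \<Gamma> F ns a Hs) \<psi>') \<psi>"
    "map (sapp \<psi>') (imitation_args \<Gamma> ns a Hs) = us"
    "list_all2 sim us (map (sapp \<psi>) ss)"
    "tsize (sapp \<psi> (flex_app \<Gamma> F ns)) = Suc (\<Sum>u\<leftarrow>us. Suc (tsize u))"
proof -
  have F: "flex_args \<Gamma> F ns" "resty (headty a) = resty (snd F)" "rigid a"
    using im by (auto simp: imitates_def imitable_rigid)
  obtain a' us where us: "sapp \<psi> (flex_app \<Gamma> F ns) = Ap a' us" "sim_head a' a"
    "list_all2 sim us (map (sapp \<psi>) ss)" "list_all2 (hopat \<Gamma>) us (argtys (headty a))"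
    "\<And>u. u \<in> set us \<Longrightarrow> bvars u \<subseteq> set ns"
    using sim_rigid_instanceE[OF F assms(2) sim] by blast
  obtain \<psi>' where \<psi>': "is_subst \<psi>'" "\<And>X. X \<notin> set Hs \<Longrightarrow> \<psi>' X = \<psi> X"
    "map (sapp \<psi>') (imitation_args \<Gamma> ns a Hs) = us"
    using instantiate_eta_apps[OF im assms(2) us(4,5)] by blast
  have "sapp \<psi>' (abstract_bvs \<Gamma> ns (imitation \<Gamma> ns a Hs)) = abstract_bvs \<Gamma> ns (Ap a us)"
    using sapp_abstract_bvs[OF hopat_imitation[OF im] is_subst_typed[OF \<psi>'(1)]] F(3) \<psi>'(3)
    by (simp add: imitation_def)
  moreover have "\<psi> F = abstract_bvs \<Gamma> ns (Ap a' us)"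
    using abstract_bvs_eta[OF is_subst_typed[OF assms(2)] F(1)] us(1) by metis
  moreover have "sim (Ap a us) (Ap a' us)"
    using us(2) by (auto intro: list.rel_refl_strong sim_head_sym)
  ultimately have "sim (sapp \<psi>' (single F (abstract_bvs \<Gamma> ns (imitation \<Gamma> ns a Hs)) F)) (\<psi> F)"
    by (simp add: single_def sim_abstract_bvs)
  then have "sim_on S (comp (imitation_subst \<Gamma> F ns a Hs) \<psi>') \<psi>"
    using \<psi>'(1,2) assms(3) by (intro sim_on_comp_bind[OF _ Dom_single]) auto
  moreover have "\<psi>' X = \<psi> X" if "X \<in> S" for X using \<psi>'(2) assms(3) that by blast
  ultimately show thesis using that[OF \<psi>'(1) _ _ \<psi>'(3) us(3)] us(1) by simp
qed

end

section \<open>Solutions of unification problems\<close>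

definition well_typed :: "eqn set \<Rightarrow> bool" where
  "well_typed P \<longleftrightarrow> (\<forall>e\<in>P. \<exists>\<Gamma> T. hopat \<Gamma> (fst e) T \<and> hopat \<Gamma> (snd e) T)"

definition lhs_vars :: "eqn set \<Rightarrow> var set" where
  "lhs_vars P = (\<Union>e\<in>P. fv (fst e))"

definition rhs_vars :: "eqn set \<Rightarrow> var set" where
  "rhs_vars P = (\<Union>e\<in>P. fv (snd e))"

lemma lhs_vars_simps [simp]:
  "lhs_vars {} = {}" "lhs_vars (insert e P) = fv (fst e) \<union> lhs_vars P"
  "lhs_vars (P \<union> Q) = lhs_vars P \<union> lhs_vars Q"
  by (simp_all add: lhs_vars_def)

lemma rhs_vars_simps [simp]:
  "rhs_vars {} = {}" "rhs_vars (insert e P) = fv (snd e) \<union> rhs_vars P"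
  "rhs_vars (P \<union> Q) = rhs_vars P \<union> rhs_vars Q"
  by (simp_all add: rhs_vars_def)

lemma lhs_vars_remove: "e \<in> P \<Longrightarrow> lhs_vars P = fv (fst e) \<union> lhs_vars (P - {e})"
  by (auto simp: lhs_vars_def)

lemma rhs_vars_remove: "e \<in> P \<Longrightarrow> rhs_vars P = fv (snd e) \<union> rhs_vars (P - {e})"
  by (auto simp: rhs_vars_def)

abbreviation vars :: "eqn set \<Rightarrow> var set" where
  "vars P \<equiv> lhs_vars P \<union> rhs_vars P"

lemma cvars_eq: "cvars P \<sigma> = vars P \<union> Dom \<sigma> \<union> (\<Union>X\<in>Dom \<sigma>. fv (\<sigma> X))"
  by (auto simp: cvars_def lhs_vars_def rhs_vars_def split_beta)

lemma finite_cvars: "finite P \<Longrightarrow> is_subst \<sigma> \<Longrightarrow> finite (cvars P \<sigma>)"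
  by (auto simp: cvars_def is_subst_iff)

lemma fv_subset_cvars:
  "e \<in> P \<Longrightarrow> fv (fst e) \<subseteq> cvars P \<sigma>" "e \<in> P \<Longrightarrow> fv (snd e) \<subseteq> cvars P \<sigma>"
  by (auto simp: cvars_eq lhs_vars_def rhs_vars_def)

lemma fv_binding_subset: "X \<in> W \<Longrightarrow> fv (\<sigma> X) \<subseteq> W \<union> cvars P \<sigma>"
  by (cases "X \<in> Dom \<sigma>") (auto simp: cvars_eq, auto simp: Dom_def)

lemma Papp_eq: "Papp \<theta> P = (\<lambda>e. (sapp \<theta> (fst e), sapp \<theta> (snd e))) ` P"
  by (simp add: Papp_def split_beta)

lemma well_typed_Un: "well_typed (P \<union> Q) \<longleftrightarrow> well_typed P \<and> well_typed Q"
  by (auto simp: well_typed_def)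

lemma well_typed_subset: "well_typed P \<Longrightarrow> Q \<subseteq> P \<Longrightarrow> well_typed Q"
  by (auto simp: well_typed_def)

lemma well_typedE:
  assumes "well_typed P" "(l, r) \<in> P"
  obtains \<Gamma> T where "hopat \<Gamma> l T" "hopat \<Gamma> r T"
  using assms by (force simp: well_typed_def)

lemma well_typed_singleton: "hopat \<Gamma> l T \<Longrightarrow> hopat \<Gamma> r T \<Longrightarrow> well_typed {(l, r)}"
  by (auto simp: well_typed_def)

lemma well_typed_Lam: "well_typed {(Lam T t, Lam T s)} \<Longrightarrow> well_typed {(t, s)}"
  using hopat_Lam_Lam by (fastforce simp: well_typed_def)

lemma well_typed_zip:
  assumes "list_all2 (hopat \<Gamma>) ts Ts" "list_all2 (hopat \<Gamma>) ss Ts"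
  shows "well_typed (set (zip ts ss))"
  using assms by (fastforce simp: well_typed_def in_set_zip list_all2_conv_all_nth)

lemma well_typed_Papp:
  assumes "well_typed P" "typed_subst \<theta>"
  shows "well_typed (Papp \<theta> P)"
  unfolding well_typed_def
proof
  fix e' assume "e' \<in> Papp \<theta> P"
  then obtain e where "e \<in> P" "e' = (sapp \<theta> (fst e), sapp \<theta> (snd e))" by (auto simp: Papp_eq)
  then show "\<exists>\<Gamma> T. hopat \<Gamma> (fst e') T \<and> hopat \<Gamma> (snd e') T"
    using assms hopat_sapp unfolding well_typed_def by fastforce
qed

lemma Papp_ident:
  assumes "well_typed P" "vars P \<inter> Dom \<theta> = {}"
  shows "Papp \<theta> P = P"
proof -
  have "(sapp \<theta> (fst e), sapp \<theta> (snd e)) = e" if e: "e \<in> P" for e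
  proof -
    obtain \<Gamma> T where "hopat \<Gamma> (fst e) T" "hopat \<Gamma> (snd e) T"
      using assms(1) e by (auto simp: well_typed_def)
    moreover have "fv (fst e) \<inter> Dom \<theta> = {}" "fv (snd e) \<inter> Dom \<theta> = {}"
      using assms(2) e by (auto simp: lhs_vars_def rhs_vars_def)
    ultimately show ?thesis by (simp add: sapp_ident)
  qed
  then show ?thesis by (simp add: Papp_eq)
qed

lemma Papp_eps: "well_typed P \<Longrightarrow> Papp eps P = P"
  by (rule Papp_ident) (simp_all add: Dom_def eps_def)

fun flex_headed :: "trm \<Rightarrow> bool" where
  "flex_headed (Lam T t) \<longleftrightarrow> flex_headed t"
| "flex_headed (Ap h ts) \<longleftrightarrow> (\<exists>X. h = FV X)"

lemma flex_headed_sapp: "flex_headed (sapp \<theta> t) \<Longrightarrow> flex_headed t"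
proof (induction t)
  case (Ap h ts)
  then show ?case using rigid_or_flex[of h] by auto
qed simp

lemma flex_headed_eta_app: "flex_headed (eta_app H xs T)"
proof -
  have "flex_headed (mk_abs Ts u) \<longleftrightarrow> flex_headed u" for Ts u by (induction Ts) auto
  then show ?thesis by (simp add: eta_app_def)
qed

text \<open>The flag decreases under Ori, which leaves the size unchanged.\<close>

definition weight :: "subst \<Rightarrow> eqn \<Rightarrow> nat" where
  "weight \<psi> e = tsize (sapp \<psi> (fst e)) + of_bool (flex_headed (snd e))"

definition total_weight :: "subst \<Rightarrow> eqn set \<Rightarrow> nat" where
  "total_weight \<psi> P = sum (weight \<psi>) P"

lemma weight_pos: "0 < weight \<psi> e"
  by (simp add: weight_def)

lemma total_weight_remove:
  "finite P \<Longrightarrow> e \<in> P \<Longrightarrow> total_weight \<psi> P = weight \<psi> e + total_weight \<psi> (P - {e})"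
  unfolding total_weight_def by (rule sum.remove)

lemma total_weight_Un_le:
  "finite P \<Longrightarrow> finite Q \<Longrightarrow> total_weight \<psi> (P \<union> Q) \<le> total_weight \<psi> P + total_weight \<psi> Q"
  using sum.union_inter[of P Q "weight \<psi>"] by (simp add: total_weight_def)

lemma sum_set_le_sum_list: "sum f (set xs) \<le> (\<Sum>x\<leftarrow>xs. f x :: nat)"
proof (induction xs)
  case (Cons x xs)
  then show ?case by (cases "x \<in> set xs") (simp_all add: insert_absorb)
qed simp

lemma total_weight_zip:
  assumes "length ts = length ss"
  shows "total_weight \<psi> (set (zip ts ss)) \<le> (\<Sum>t\<leftarrow>ts. Suc (tsize (sapp \<psi> t)))"
proof -
  have "total_weight \<psi> (set (zip ts ss)) \<le> (\<Sum>e\<leftarrow>zip ts ss. weight \<psi> e)"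
    unfolding total_weight_def by (rule sum_set_le_sum_list)
  also have "\<dots> \<le> (\<Sum>e\<leftarrow>zip ts ss. Suc (tsize (sapp \<psi> (fst e))))"
    by (rule sum_list_mono) (simp add: weight_def)
  also have "\<dots> = (\<Sum>t\<leftarrow>map fst (zip ts ss). Suc (tsize (sapp \<psi> t)))"
    by (simp only: map_map o_def)
  finally show ?thesis using assms by simp
qed

context similarity_degree
begin

definition unifies :: "subst \<Rightarrow> eqn set \<Rightarrow> bool" where
  "unifies \<psi> P \<longleftrightarrow> (\<forall>e\<in>P. sim (sapp \<psi> (fst e)) (sapp \<psi> (snd e)))"

lemma unifies_Un [simp]: "unifies \<psi> (P \<union> Q) \<longleftrightarrow> unifies \<psi> P \<and> unifies \<psi> Q"
  by (auto simp: unifies_def)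

lemma unifies_subset: "unifies \<psi> P \<Longrightarrow> Q \<subseteq> P \<Longrightarrow> unifies \<psi> Q"
  by (auto simp: unifies_def)

lemma unifiesD: "unifies \<psi> P \<Longrightarrow> (l, r) \<in> P \<Longrightarrow> sim (sapp \<psi> l) (sapp \<psi> r)"
  by (force simp: unifies_def)

lemma unifies_singleton [simp]: "unifies \<psi> {(l, r)} \<longleftrightarrow> sim (sapp \<psi> l) (sapp \<psi> r)"
  by (simp add: unifies_def)

lemma unifies_zip:
  "list_all2 sim (map (sapp \<psi>) ts) (map (sapp \<psi>) ss) \<Longrightarrow> unifies \<psi> (set (zip ts ss))"
  by (auto simp: unifies_def in_set_zip list_all2_conv_all_nth)

lemma Papp_factor:
  assumes "well_typed P" "vars P \<subseteq> S" "sim_on S (comp \<theta> \<psi>') \<psi>"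
    and "is_subst \<theta>" "is_subst \<psi>'" "is_subst \<psi>" "e \<in> P"
  shows "sim (sapp \<psi>' (sapp \<theta> (fst e))) (sapp \<psi> (fst e))"
    and "sim (sapp \<psi>' (sapp \<theta> (snd e))) (sapp \<psi> (snd e))"
proof -
  obtain \<Gamma> T where "hopat \<Gamma> (fst e) T" "hopat \<Gamma> (snd e) T"
    using assms(1,7) by (auto simp: well_typed_def)
  moreover have "fv (fst e) \<subseteq> S" "fv (snd e) \<subseteq> S"
    using assms(2,7) by (auto simp: lhs_vars_def rhs_vars_def)
  ultimately show "sim (sapp \<psi>' (sapp \<theta> (fst e))) (sapp \<psi> (fst e))"
    "sim (sapp \<psi>' (sapp \<theta> (snd e))) (sapp \<psi> (snd e))"
    using sim_sapp_factor assms(3-6) by blast+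
qed

lemma unifies_Papp:
  assumes "well_typed P" "vars P \<subseteq> S" "sim_on S (comp \<theta> \<psi>') \<psi>"
    and "is_subst \<theta>" "is_subst \<psi>'" "is_subst \<psi>" "unifies \<psi> P"
  shows "unifies \<psi>' (Papp \<theta> P)"
proof -
  have "sim (sapp \<psi>' (sapp \<theta> (fst e))) (sapp \<psi>' (sapp \<theta> (snd e)))" if "e \<in> P" for e
    using Papp_factor[OF assms(1-6) that] assms(7) that sim_trans sim_sym
    unfolding unifies_def by blast
  then show ?thesis by (auto simp: unifies_def Papp_eq)
qed

lemma total_weight_Papp_le:
  assumes "well_typed P" "vars P \<subseteq> S" "sim_on S (comp \<theta> \<psi>') \<psi>"
    and "is_subst \<theta>" "is_subst \<psi>'" "is_subst \<psi>" "finite P"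
  shows "total_weight \<psi>' (Papp \<theta> P) \<le> total_weight \<psi> P"
proof -
  let ?app = "\<lambda>e. (sapp \<theta> (fst e), sapp \<theta> (snd e))"
  have "total_weight \<psi>' (Papp \<theta> P) \<le> (\<Sum>e\<in>P. weight \<psi>' (?app e))"
    unfolding total_weight_def Papp_eq
    using sum_image_le[of P "weight \<psi>'" ?app] assms(7) by (simp add: o_def)
  also have "\<dots> \<le> total_weight \<psi> P"
    unfolding total_weight_def
  proof (rule sum_mono)
    fix e assume "e \<in> P"
    then have "tsize (sapp \<psi>' (sapp \<theta> (fst e))) = tsize (sapp \<psi> (fst e))"
      using sim_tsize[OF Papp_factor(1)[OF assms(1-6)]] by blast
    moreover have "of_bool (flex_headed (sapp \<theta> (snd e))) \<le> (of_bool (flex_headed (snd e)) :: nat)"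
      using flex_headed_sapp by auto
    ultimately show "weight \<psi>' (?app e) \<le> weight \<psi> e" by (simp add: weight_def)
  qed
  finally show ?thesis .
qed

definition completion :: "var set \<Rightarrow> subst \<Rightarrow> eqn set \<Rightarrow> subst \<Rightarrow> subst \<Rightarrow> bool" where
  "completion W \<tau> P \<sigma> \<psi> \<longleftrightarrow> finite P \<and> well_typed P \<and> is_subst \<sigma> \<and> is_subst \<psi> \<and>
     unifies \<psi> P \<and> sim_on W (comp \<sigma> \<psi>) \<tau>"

lemma completion_init:
  assumes "hopat \<Gamma> l T" "hopat \<Gamma> r T" "is_subst \<tau>" "sim (sapp \<tau> l) (sapp \<tau> r)"
  shows "completion W \<tau> {(l, r)} eps \<tau>"
  using assms
  by (simp add: completion_def well_typed_singleton is_subst_eps comp_eps_left is_subst_typed)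

lemma completion_more_general: "completion W \<tau> {} \<sigma> \<psi> \<Longrightarrow> is_subst \<sigma> \<and> more_general Rc d W \<sigma> \<tau>"
  unfolding completion_def more_general_iff by blast

lemma completion_step:
  assumes compl: "completion W \<tau> P \<sigma> \<psi>" and "e \<in> P"
    and \<theta>: "is_subst \<theta>" "is_subst \<psi>'" "sim_on (W \<union> cvars P \<sigma>) (comp \<theta> \<psi>') \<psi>"
    and E: "finite E" "well_typed E" "unifies \<psi>' E" "total_weight \<psi>' E < weight \<psi> e"
  shows "completion W \<tau> (E \<union> Papp \<theta> (P - {e})) (comp \<sigma> \<theta>) \<psi>'"
    and "total_weight \<psi>' (E \<union> Papp \<theta> (P - {e})) < total_weight \<psi> P"
proof -
  let ?R = "P - {e}"
  have P: "finite P" "well_typed P" "is_subst \<sigma>" "is_subst \<psi>" "unifies \<psi> P"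
    "sim_on W (comp \<sigma> \<psi>) \<tau>"
    using compl by (auto simp: completion_def)
  have R: "well_typed ?R" "finite ?R" "unifies \<psi> ?R" "vars ?R \<subseteq> W \<union> cvars P \<sigma>"
    using P(1) well_typed_subset[OF P(2), of ?R] unifies_subset[OF P(5), of ?R]
    by (auto simp: cvars_eq lhs_vars_def rhs_vars_def)
  have typed: "typed_subst \<theta>" "typed_subst \<psi>'" "typed_subst \<sigma>" "typed_subst \<psi>"
    using \<theta>(1,2) P(3,4) by (simp_all add: is_subst_typed)
  have "sim_on W (comp \<sigma> (comp \<theta> \<psi>')) (comp \<sigma> \<psi>)"
    by (rule sim_on_comp[OF \<theta>(3) fv_binding_subset]) (simp_all add: typed typed_subst_comp)
  then have "sim_on W (comp (comp \<sigma> \<theta>) \<psi>') \<tau>"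
    unfolding comp_assoc[OF typed(3,1,2)] using P(6) by (rule sim_on_trans)
  moreover have "unifies \<psi>' (Papp \<theta> ?R)" by (rule unifies_Papp[OF R(1,4) \<theta>(3,1,2) P(4) R(3)])
  moreover have "well_typed (Papp \<theta> ?R)" by (rule well_typed_Papp[OF R(1) typed(1)])
  moreover have "finite (Papp \<theta> ?R)" using R(2) by (simp add: Papp_eq)
  ultimately show "completion W \<tau> (E \<union> Papp \<theta> ?R) (comp \<sigma> \<theta>) \<psi>'"
    using E(1-3) \<theta>(2) is_subst_comp[OF P(3) \<theta>(1)] by (simp add: completion_def well_typed_Un)
  have "total_weight \<psi>' (E \<union> Papp \<theta> ?R) \<le> total_weight \<psi>' E + total_weight \<psi>' (Papp \<theta> ?R)"
    using E(1) R(2) by (intro total_weight_Un_le) (simp_all add: Papp_eq)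
  also have "\<dots> < weight \<psi> e + total_weight \<psi> ?R"
    using E(4) total_weight_Papp_le[OF R(1,4) \<theta>(3,1,2) P(4) R(2)] by linarith
  finally show "total_weight \<psi>' (E \<union> Papp \<theta> ?R) < total_weight \<psi> P"
    using total_weight_remove[OF P(1) assms(2)] by simp
qed

lemma completion_bind:
  assumes "completion W \<tau> P \<sigma> \<psi>" "e \<in> P"
    and "is_subst \<theta>" "more_general Rc d (W \<union> cvars P \<sigma>) \<theta> \<psi>"
  obtains \<psi>' where "completion W \<tau> (Papp \<theta> (P - {e})) (comp \<sigma> \<theta>) \<psi>'"
    "total_weight \<psi>' (Papp \<theta> (P - {e})) < total_weight \<psi> P"
proof -
  obtain \<psi>' where "is_subst \<psi>'" "sim_on (W \<union> cvars P \<sigma>) (comp \<theta> \<psi>') \<psi>"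
    using assms(4) more_general_iff by blast
  note step = completion_step[OF assms(1-3) this, of "{}", unfolded Un_empty_left]
  show thesis
    by (rule that[OF step]) (simp_all add: well_typed_def unifies_def total_weight_def weight_pos)
qed

lemma completion_replace:
  assumes "completion W \<tau> P \<sigma> \<psi>" "e \<in> P"
    and "finite E" "well_typed E" "unifies \<psi> E" "total_weight \<psi> E < weight \<psi> e"
  shows "completion W \<tau> (E \<union> (P - {e})) \<sigma> \<psi>"
    and "total_weight \<psi> (E \<union> (P - {e})) < total_weight \<psi> P"
proof -
  have P: "is_subst \<sigma>" "is_subst \<psi>" "well_typed P" using assms(1) by (simp_all add: completion_def)
  have eps: "comp eps \<psi> = \<psi>" "comp \<sigma> eps = \<sigma>" "Papp eps (P - {e}) = P - {e}"
    using P(1,2) well_typed_subset[OF P(3), of "P - {e}"]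
    by (auto simp: comp_eps_left comp_eps_right is_subst_typed Papp_eps)
  then show "completion W \<tau> (E \<union> (P - {e})) \<sigma> \<psi>"
    "total_weight \<psi> (E \<union> (P - {e})) < total_weight \<psi> P"
    using completion_step[OF assms(1,2) is_subst_eps P(2) _ assms(3-6)] by simp_all
qed

lemma completion_Lam:
  assumes "completion W \<tau> P \<sigma> \<psi>" "(Lam T t, Lam T s) \<in> P"
  shows "completion W \<tau> (insert (t, s) (P - {(Lam T t, Lam T s)})) \<sigma> \<psi>"
    and "total_weight \<psi> (insert (t, s) (P - {(Lam T t, Lam T s)})) < total_weight \<psi> P"
proof -
  have P: "well_typed P" "unifies \<psi> P" using assms(1) by (simp_all add: completion_def)
  have typed: "well_typed {(t, s)}"
    by (rule well_typed_Lam[where T = T, OF well_typed_subset[OF P(1)]]) (simp add: assms(2))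
  have unifies: "unifies \<psi> {(t, s)}" using unifiesD[OF P(2) assms(2)] by simp
  have weight: "total_weight \<psi> {(t, s)} < weight \<psi> (Lam T t, Lam T s)"
    by (simp add: total_weight_def weight_def)
  note replace =
    completion_replace[OF assms _ typed unifies weight, unfolded insert_is_Un[symmetric]]
  show "completion W \<tau> (insert (t, s) (P - {(Lam T t, Lam T s)})) \<sigma> \<psi>"
    "total_weight \<psi> (insert (t, s) (P - {(Lam T t, Lam T s)})) < total_weight \<psi> P"
    by (rule replace; simp)+
qed

end

section \<open>Descending relations\<close>

definition descending :: "('a \<Rightarrow> 'a \<Rightarrow> bool) \<Rightarrow> (nat \<Rightarrow> 'a \<Rightarrow> bool) \<Rightarrow> bool" where
  "descending r I \<longleftrightarrow> (\<forall>n c c'. I n c \<longrightarrow> r c c' \<longrightarrow> (\<exists>m<n. I m c'))"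

lemma descending_terminates:
  assumes "descending r I" "I n c"
  shows "terminates r c"
proof -
  have False if "I n (f 0)" "\<forall>i. r (f i) (f (Suc i))" for f
    using that
  proof (induction n arbitrary: f rule: less_induct)
    case (less n)
    then obtain m where "m < n" "I m (f (Suc 0))" using assms(1) unfolding descending_def by blast
    then show False using less.IH[of m "\<lambda>i. f (Suc i)"] less.prems(2) by simp
  qed
  then show ?thesis using assms(2) unfolding terminates_def by blast
qed

lemma descending_reachable:
  assumes "descending r I" "r\<^sup>*\<^sup>* c c'" "I n c"
  shows "\<exists>m. I m c'"
  using assms(2,3)
proof induction
  case (step c' c'')
  then show ?case using assms(1) unfolding descending_def by blast
qed blast

lemma terminates_imp_final:
  assumes "terminates r c"
  shows "\<exists>c'. r\<^sup>*\<^sup>* c c' \<and> final r c'"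
proof (rule ccontr)
  assume no_final: "\<not> ?thesis"
  let ?P = "\<lambda>(n :: nat) x. r\<^sup>*\<^sup>* c x \<and> (n = 0 \<longrightarrow> x = c)"
  have "\<exists>y. ?P (Suc n) y \<and> r x y" if "?P n x" for x n
  proof -
    have "\<not> final r x" using that no_final by blast
    then obtain y where "r x y" unfolding final_def by blast
    then show ?thesis using that by (auto intro: rtranclp.rtrancl_into_rtrancl)
  qed
  then obtain f where f: "\<And>n. ?P n (f n) \<and> r (f n) (f (Suc n))"
    using dependent_nat_choice[of ?P "\<lambda>_. r"] by auto
  then have "f 0 = c" by blast
  then show False using assms f unfolding terminates_def by blast
qed

section \<open>VarElim\<close>

text \<open>
  Rule VE1 does not apply its binding of \<open>F\<close> to the rest of the problem; linearity of the left-hand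
  sides makes this harmless.
\<close>

abbreviation lhs_disjoint :: "eqn set \<Rightarrow> bool" where
  "lhs_disjoint Q \<equiv> pairwise (\<lambda>e e'. disjnt (fv (fst e)) (fv (fst e'))) Q"

definition lhs_linear :: "eqn set \<Rightarrow> bool" where
  "lhs_linear Q \<longleftrightarrow>
     (\<forall>e\<in>Q. flex_headed (fst e)) \<and> lhs_disjoint Q \<and> disjnt (lhs_vars Q) (rhs_vars Q)"

lemma lhs_linear_subset:
  assumes "lhs_linear Q" "Q' \<subseteq> Q"
  shows "lhs_linear Q'"
proof -
  have "lhs_vars Q' \<subseteq> lhs_vars Q" "rhs_vars Q' \<subseteq> rhs_vars Q"
    using assms(2) by (auto simp: lhs_vars_def rhs_vars_def)
  moreover have "lhs_disjoint Q'"
    using pairwise_subset assms unfolding lhs_linear_def by blast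
  ultimately show ?thesis using assms unfolding lhs_linear_def disjnt_def by blast
qed

lemma lhs_linear_occurs:
  assumes "lhs_linear Q" "e \<in> Q"
  shows "fv (fst e) \<inter> fv (snd e) = {}" "fv (fst e) \<inter> vars (Q - {e}) = {}"
  using assms unfolding lhs_linear_def lhs_vars_def rhs_vars_def pairwise_def disjnt_def by blast+

lemma pairwise_Un_disjnt:
  assumes "pairwise (\<lambda>x y. disjnt (f x) (f y)) A" "pairwise (\<lambda>x y. disjnt (f x) (f y)) B"
    and "\<And>x y. x \<in> A \<Longrightarrow> y \<in> B \<Longrightarrow> disjnt (f x) (f y)"
  shows "pairwise (\<lambda>x y. disjnt (f x) (f y)) (A \<union> B)"
  using assms unfolding pairwise_def by (metis Un_iff disjnt_sym)

lemma lhs_linear_replace: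
  assumes "lhs_linear Q" "e \<in> Q" "lhs_linear E"
    and "lhs_vars E \<subseteq> fv (fst e) \<union> N" "rhs_vars E \<subseteq> fv (snd e)" "N \<inter> vars Q = {}"
  shows "lhs_linear (E \<union> (Q - {e}))"
proof -
  let ?R = "Q - {e}"
  have R: "lhs_linear ?R" using lhs_linear_subset[OF assms(1)] by blast
  note Q = lhs_vars_remove[OF assms(2)] rhs_vars_remove[OF assms(2)]
  have "lhs_vars E \<inter> vars ?R = {}" using lhs_linear_occurs(2)[OF assms(1,2)] assms(4,6) Q by blast
  moreover have "lhs_vars ?R \<inter> rhs_vars E = {}"
    using assms(1,5) Q by (auto simp: lhs_linear_def disjnt_def)
  moreover have "fv (fst e1) \<inter> fv (fst e2) = {}" if "e1 \<in> E" "e2 \<in> ?R" for e1 e2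
    using calculation(1) that unfolding lhs_vars_def by blast
  then have "lhs_disjoint (E \<union> ?R)"
    using assms(3) R by (intro pairwise_Un_disjnt) (simp_all add: lhs_linear_def disjnt_def)
  ultimately show ?thesis
    using assms(3) R by (auto simp: lhs_linear_def disjnt_def Int_Un_distrib Int_Un_distrib2)
qed

lemma lhs_linear_Papp:
  assumes "lhs_linear Q" "well_typed Q" "typed_subst \<theta>"
    and "lhs_vars Q \<inter> Dom \<theta> = {}" "\<And>X. fv (\<theta> X) \<subseteq> {X, H}" "H \<notin> lhs_vars Q"
  shows "lhs_linear (Papp \<theta> Q)" "vars (Papp \<theta> Q) \<subseteq> vars Q \<union> {H}"
proof -
  have typed: "\<exists>\<Gamma> T. hopat \<Gamma> (fst e) T \<and> hopat \<Gamma> (snd e) T" if "e \<in> Q" for e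
    using assms(2) that by (auto simp: well_typed_def)
  have lhs: "sapp \<theta> (fst e) = fst e" if "e \<in> Q" for e
  proof -
    have "fv (fst e) \<inter> Dom \<theta> = {}" using assms(4) that by (auto simp: lhs_vars_def)
    then show ?thesis using typed[OF that] sapp_ident by blast
  qed
  have rhs: "fv (sapp \<theta> (snd e)) \<subseteq> fv (snd e) \<union> {H}" if "e \<in> Q" for e
    using typed[OF that] fv_sapp[OF _ assms(3), of _ "snd e"] assms(5) by blast
  have Papp: "Papp \<theta> Q = (\<lambda>e. (fst e, sapp \<theta> (snd e))) ` Q"
    using lhs by (auto simp: Papp_eq intro!: image_cong)
  have vars: "lhs_vars (Papp \<theta> Q) = lhs_vars Q" "rhs_vars (Papp \<theta> Q) \<subseteq> rhs_vars Q \<union> {H}"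
    using rhs by (auto simp: Papp lhs_vars_def rhs_vars_def)
  then show "vars (Papp \<theta> Q) \<subseteq> vars Q \<union> {H}" by blast
  have "disjnt (lhs_vars (Papp \<theta> Q)) (rhs_vars (Papp \<theta> Q))"
    using vars assms(1,6) by (auto simp: lhs_linear_def disjnt_def)
  moreover have "lhs_disjoint (Papp \<theta> Q)"
    using assms(1) unfolding Papp lhs_linear_def pairwise_def by fastforce
  ultimately show "lhs_linear (Papp \<theta> Q)"
    using assms(1) by (auto simp: lhs_linear_def Papp)
qed

lemma lhs_linear_eta_apps:
  fixes \<Gamma> :: "ty list" and ns :: "nat list"
  assumes "distinct Hs" "length Hs = length Ts" "length ss = length Ts"
    and "\<And>s. s \<in> set ss \<Longrightarrow> set Hs \<inter> fv s = {}"
  defines "E \<equiv> set (zip (eta_apps Hs (bvatoms \<Gamma> ns) Ts) ss)"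
  shows "lhs_linear E" "lhs_vars E \<subseteq> set Hs" "rhs_vars E \<subseteq> (\<Union>s\<in>set ss. fv s)"
proof -
  have E: "e \<in> E \<longleftrightarrow> (\<exists>i<length Ts. e = (eta_app (Hs ! i) (bvatoms \<Gamma> ns) (Ts ! i), ss ! i))" for e
    using assms(2,3) by (force simp: E_def in_set_zip)
  show "lhs_vars E \<subseteq> set Hs" "rhs_vars E \<subseteq> (\<Union>s\<in>set ss. fv s)"
    using assms(2,3) by (auto 0 3 simp: lhs_vars_def rhs_vars_def E intro: nth_mem)
  then have "disjnt (lhs_vars E) (rhs_vars E)" using assms(4) unfolding disjnt_def by blast
  then show "lhs_linear E"
    using assms(1-3)
    by (auto simp: lhs_linear_def pairwise_def E flex_headed_eta_app nth_eq_iff_index_eq)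
qed

abbreviation common_args :: "nat list \<Rightarrow> nat list \<Rightarrow> nat list" where
  "common_args ns ms \<equiv> filter (\<lambda>n. n \<in> set ms) ns"

lemma prunes_common_args:
  assumes "flex_args \<Gamma> F ns" "flex_args \<Gamma> G ms" "F \<noteq> G" "resty (snd F) = resty (snd G)"
    and "snd H = arrows (map typeof (bvatoms \<Gamma> (common_args ns ms))) (resty (snd F))"
  shows "prunes \<Gamma> ((\<lambda>_. ms)(F := ns)) {F, G} H (common_args ns ms)"
proof -
  have "distinct (common_args ns ms)" using assms(1) by (simp add: flex_args_def)
  then show ?thesis
    using flex_args_sublist[OF assms(1) _ _ assms(5)] assms(1-4) by (auto simp: prunes_def)
qed

lemma upd_abstr_eq_prune_subst:
  assumes "flex_args \<Gamma> F ns" "flex_args \<Gamma> G ms" "F \<noteq> G"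
  shows "eta_var(F := abstr (argtys (snd F)) (bvatoms \<Gamma> ns) (flex_app \<Gamma> H ks),
      G := abstr (argtys (snd G)) (bvatoms \<Gamma> ms) (flex_app \<Gamma> H ks)) =
    prune_subst \<Gamma> ((\<lambda>_. ms)(F := ns)) {F, G} H ks"
  using assms
  by (auto simp: prune_subst_def fun_eq_iff override_on_def eps_def abstr_eq_abstract_bvs)

lemma map_eta_app_eq_eta_apps:
  assumes "length Hs = length ss" "length Ts = length ss"
  shows "map (\<lambda>i. eta_app (Hs ! i) xs (Ts ! i)) [0..<length ss] = eta_apps Hs xs Ts"
    and "map (\<lambda>i. (eta_app (Hs ! i) xs (Ts ! i), ss ! i)) [0..<length ss] =
      zip (eta_apps Hs xs Ts) ss"
  using assms by (auto intro!: nth_equalityI)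

lemma single_abstr_eq_imitation_subst:
  assumes "flex_args \<Gamma> F ns" "length Hs = length ss" "length (argtys (headty a)) = length ss"
  shows "single F (abstr (argtys (snd F)) (bvatoms \<Gamma> ns)
      (Ap a (map (\<lambda>i. eta_app (Hs ! i) (bvatoms \<Gamma> ns) (argtys (headty a) ! i)) [0..<length ss]))) =
    imitation_subst \<Gamma> F ns a Hs"
  by (simp add: map_eta_app_eq_eta_apps[OF assms(2,3)] abstr_eq_abstract_bvs[OF assms(1)]
      imitation_def)

lemma ve_step_imitate:
  assumes im: "imitates \<Gamma> F ns a Hs" and len: "length Hs = length ss"
    and e: "(flex_app \<Gamma> F ns, Ap a ss) \<in> Q" and fresh: "set Hs \<inter> (A \<union> cvars Q \<phi>) = {}"
  defines "Es \<equiv> imitation_args \<Gamma> ns a Hs"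
  shows "ve_step A (Q, \<phi>)
    (set (zip Es ss) \<union> (Q - {(flex_app \<Gamma> F ns, Ap a ss)}), comp \<phi> (imitation_subst \<Gamma> F ns a Hs))"
proof (rule ve1[OF refl e _ _ len _ _ _ refl])
  have F: "flex_args \<Gamma> F ns" and len': "length (argtys (headty a)) = length ss"
    using im len imitates_length[OF im] by (simp_all add: imitates_def)
  show "imitation_subst \<Gamma> F ns a Hs = single F (abstr (argtys (snd F)) (bvatoms \<Gamma> ns)
      (Ap a (map (\<lambda>i. eta_app (Hs ! i) (bvatoms \<Gamma> ns) (argtys (headty a) ! i)) [0..<length ss])))"
    by (rule single_abstr_eq_imitation_subst[OF F len len', symmetric])
  show "set (zip Es ss) \<union> (Q - {(flex_app \<Gamma> F ns, Ap a ss)}) =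
    set (map (\<lambda>i. (eta_app (Hs ! i) (bvatoms \<Gamma> ns) (argtys (headty a) ! i), ss ! i))
      [0..<length ss]) \<union> (Q - {(flex_app \<Gamma> F ns, Ap a ss)})"
    by (simp only: Es_def map_eta_app_eq_eta_apps[OF len len'])
  show "\<forall>i<length ss. snd (Hs ! i) = arrows (map typeof (bvatoms \<Gamma> ns)) (argtys (headty a) ! i)"
    using im len by (auto simp: imitates_def list_all2_conv_all_nth)
qed (use im fresh in \<open>auto simp: imitates_def imitable_def\<close>)

lemma imitatesE:
  assumes "hopat \<Gamma> (Ap (FV F) xs) T" "hopat \<Gamma> (Ap a ss) T" "imitable a xs"
    and "length Hs = length ss" "distinct Hs"
    and "\<forall>i<length ss. snd (Hs ! i) = arrows (map typeof xs) (argtys (headty a) ! i)"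
  obtains ns where "xs = bvatoms \<Gamma> ns" "imitates \<Gamma> F ns a Hs"
    "list_all2 (hopat \<Gamma>) ss (argtys (headty a))"
proof -
  obtain ns where ns: "xs = bvatoms \<Gamma> ns" "flex_args \<Gamma> F ns" "T = resty (snd F)"
    using assms(1) by (auto simp: hopat_flex_iff)
  have a: "rigid_in \<Gamma> a" "list_all2 (hopat \<Gamma>) ss (argtys (headty a))" "T = resty (headty a)"
    using assms(2) imitable_rigid[OF assms(3)] by (simp_all add: hopat_rigid_iff)
  then have "imitates \<Gamma> F ns a Hs"
    using assms(3-6) ns by (auto simp: imitates_def list_all2_conv_all_nth)
  then show thesis using that ns(1) a(2) by blast
qed

lemma ve_step_prune:
  assumes "flex_args \<Gamma> F ns" "flex_args \<Gamma> G ms" "F \<noteq> G"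
    and "(flex_app \<Gamma> F ns, flex_app \<Gamma> G ms) \<in> Q" "H \<notin> A \<union> cvars Q \<phi>"
    and "snd H = arrows (map typeof (bvatoms \<Gamma> (common_args ns ms))) (resty (snd F))"
  defines "\<theta> \<equiv> prune_subst \<Gamma> ((\<lambda>_. ms)(F := ns)) {F, G} H (common_args ns ms)"
  shows "ve_step A (Q, \<phi>) (Papp \<theta> (Q - {(flex_app \<Gamma> F ns, flex_app \<Gamma> G ms)}), comp \<phi> \<theta>)"
  by (rule ve2[OF refl assms(4,3) _ _ filter_bvatoms[symmetric] assms(5,6)])
    (simp_all add: \<theta>_def upd_abstr_eq_prune_subst[OF assms(1-3)])

lemma ve_step_cases [consumes 2, case_names Abs Imitate Prune]:
  assumes "ve_step A (Q, \<phi>) (Q', \<phi>')" "well_typed Q"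
  obtains T t s where "(Lam T t, Lam T s) \<in> Q" "Q' = insert (t, s) (Q - {(Lam T t, Lam T s)})"
    "\<phi>' = \<phi>"
  | \<Gamma> F ns a ss Hs where "(flex_app \<Gamma> F ns, Ap a ss) \<in> Q" "imitates \<Gamma> F ns a Hs"
      "list_all2 (hopat \<Gamma>) ss (argtys (headty a))" "set Hs \<inter> (A \<union> cvars Q \<phi>) = {}"
      "Q' = set (zip (imitation_args \<Gamma> ns a Hs) ss) \<union>
         (Q - {(flex_app \<Gamma> F ns, Ap a ss)})"
      "\<phi>' = comp \<phi> (imitation_subst \<Gamma> F ns a Hs)"
  | \<Gamma> F ns G ms H \<theta> where "(flex_app \<Gamma> F ns, flex_app \<Gamma> G ms) \<in> Q" "F \<noteq> G"
      "\<theta> = prune_subst \<Gamma> ((\<lambda>_. ms)(F := ns)) {F, G} H (common_args ns ms)"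
      "prunes \<Gamma> ((\<lambda>_. ms)(F := ns)) {F, G} H (common_args ns ms)" "H \<notin> A \<union> cvars Q \<phi>"
      "Q' = Papp \<theta> (Q - {(flex_app \<Gamma> F ns, flex_app \<Gamma> G ms)})" "\<phi>' = comp \<phi> \<theta>"
  using assms(1)
proof cases
  case (ve_abs e T t s)
  then show thesis using that(1) by blast
next
  case (ve1 e F xs a ss Hs Ts \<theta>)
  have "imitable a xs" using ve1(5) by (simp add: imitable_def)
  then obtain \<Gamma> ns where im: "xs = bvatoms \<Gamma> ns" "imitates \<Gamma> F ns a Hs"
    "list_all2 (hopat \<Gamma>) ss (argtys (headty a))"
    using well_typedE[OF assms(2)] ve1(2,3,6,7,9) imitatesE by metis
  then have F: "flex_args \<Gamma> F ns" and len: "length (argtys (headty a)) = length ss"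
    using list_all2_lengthD[OF im(3)] by (simp_all add: imitates_def)
  have "\<theta> = imitation_subst \<Gamma> F ns a Hs"
    using ve1(10,11) im(1) single_abstr_eq_imitation_subst[OF F ve1(6) len] by simp
  moreover have "Q' = set (zip (imitation_args \<Gamma> ns a Hs) ss) \<union> (Q - {e})"
    using ve1(12) by (simp only: map_eta_app_eq_eta_apps[OF ve1(6) len] im(1))
  ultimately show thesis using that(2) im ve1(1-3,8) by blast
next
  case (ve2 e F xs G ys zs H \<theta>)
  obtain \<Gamma> T where "hopat \<Gamma> (Ap (FV F) xs) T" "hopat \<Gamma> (Ap (FV G) ys) T"
    using well_typedE[OF assms(2)] ve2(3,4) by metis
  then obtain ns ms where pat: "xs = bvatoms \<Gamma> ns" "flex_args \<Gamma> F ns" "ys = bvatoms \<Gamma> ms"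
    "flex_args \<Gamma> G ms" "resty (snd F) = resty (snd G)"
    by (auto simp: hopat_flex_iff)
  have zs: "zs = bvatoms \<Gamma> (common_args ns ms)" by (simp add: ve2(8) pat(1,3) filter_bvatoms)
  have "prunes \<Gamma> ((\<lambda>_. ms)(F := ns)) {F, G} H (common_args ns ms)"
    by (rule prunes_common_args[OF pat(2,4) ve2(5) pat(5)]) (use ve2(10) zs in simp)
  moreover have "\<theta> = prune_subst \<Gamma> ((\<lambda>_. ms)(F := ns)) {F, G} H (common_args ns ms)"
    using ve2(11) by (simp add: pat(1,3) zs upd_abstr_eq_prune_subst[OF pat(2,4) ve2(5)])
  ultimately show thesis using that(3) ve2(1-5,9) pat(1,3) by blast
qed

definition linear_within :: "var set \<Rightarrow> var set \<Rightarrow> eqn set \<Rightarrow> subst \<Rightarrow> bool" where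
  "linear_within A V Q \<phi> \<longleftrightarrow> lhs_linear Q \<and> (vars Q \<union> Dom \<phi>) \<inter> A \<subseteq> V"

lemma linear_within_update:
  assumes "linear_within A V Q \<phi>" "lhs_linear Q'" "vars Q' \<subseteq> vars Q \<union> N" "N \<inter> A = {}"
    and "Dom \<phi>' \<subseteq> Dom \<phi> \<union> vars Q"
  shows "linear_within A V Q' \<phi>'"
  using assms unfolding linear_within_def by blast

lemma linear_within_Abs:
  assumes "linear_within A V Q \<phi>" "(Lam T t, Lam T s) \<in> Q"
  shows "linear_within A V (insert (t, s) (Q - {(Lam T t, Lam T s)})) \<phi>"
proof -
  let ?E = "{(t, s)}"
  have lin: "lhs_linear Q" using assms(1) by (simp add: linear_within_def)
  then have "flex_headed t" using assms(2) by (fastforce simp: lhs_linear_def)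
  then have "lhs_linear ?E"
    using lhs_linear_occurs(1)[OF lin assms(2)]
    by (simp add: lhs_linear_def disjnt_def)
  then have "lhs_linear (?E \<union> (Q - {(Lam T t, Lam T s)}))"
    by (intro lhs_linear_replace[OF lin assms(2), of _ "{}"]) simp_all
  moreover have "vars (?E \<union> (Q - {(Lam T t, Lam T s)})) \<subseteq> vars Q"
    using lhs_vars_remove[OF assms(2)] rhs_vars_remove[OF assms(2)] by auto
  ultimately show ?thesis using linear_within_update[OF assms(1), of _ "{}"] by simp
qed

lemma linear_within_Imitate:
  assumes form: "linear_within A V Q \<phi>" and e: "(flex_app \<Gamma> F ns, Ap a ss) \<in> Q"
    and im: "imitates \<Gamma> F ns a Hs" and "length ss = length Hs"
    and fresh: "set Hs \<inter> (A \<union> cvars Q \<phi>) = {}"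
  shows "linear_within A V
    (set (zip (imitation_args \<Gamma> ns a Hs) ss) \<union> (Q - {(flex_app \<Gamma> F ns, Ap a ss)}))
    (comp \<phi> (imitation_subst \<Gamma> F ns a Hs))"
proof -
  let ?E = "set (zip (imitation_args \<Gamma> ns a Hs) ss)"
  have lin: "lhs_linear Q" using form by (simp add: linear_within_def)
  have "F \<in> vars Q" using e by (force simp: lhs_vars_def)
  then have Dom: "Dom (comp \<phi> (imitation_subst \<Gamma> F ns a Hs)) \<subseteq> Dom \<phi> \<union> vars Q"
    using Dom_comp_subset[OF is_subst_typed[OF is_subst_imitation_subst[OF im]]] Dom_single by blast
  have rhs: "(\<Union>s\<in>set ss. fv s) \<subseteq> fv (Ap a ss)" "fv (Ap a ss) \<subseteq> rhs_vars Q"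
    using e by (force simp: rhs_vars_def)+
  have len: "length Hs = length (argtys (headty a))" using imitates_length[OF im] .
  have "set Hs \<inter> vars Q = {}" using fresh by (auto simp: cvars_eq)
  moreover from this have "set Hs \<inter> fv s = {}" if "s \<in> set ss" for s using that rhs by blast
  with im assms(4) len have E: "lhs_linear ?E" "lhs_vars ?E \<subseteq> set Hs"
    "rhs_vars ?E \<subseteq> (\<Union>s\<in>set ss. fv s)"
    by (auto simp: imitates_def intro!: lhs_linear_eta_apps del: subsetI)
  ultimately have "lhs_linear (?E \<union> (Q - {(flex_app \<Gamma> F ns, Ap a ss)}))"
    using rhs(1) by (intro lhs_linear_replace[OF lin e E(1), of "set Hs"]) auto
  moreover have "vars (?E \<union> (Q - {(flex_app \<Gamma> F ns, Ap a ss)})) \<subseteq> vars Q \<union> set Hs"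
  proof -
    have "vars (?E \<union> (Q - {(flex_app \<Gamma> F ns, Ap a ss)})) \<subseteq> vars ?E \<union> vars Q"
      by (auto simp: lhs_vars_def rhs_vars_def)
    then show ?thesis using E(2,3) rhs by blast
  qed
  ultimately show ?thesis using linear_within_update[OF form _ _ _ Dom] fresh by blast
qed

lemma linear_within_Prune:
  assumes form: "linear_within A V Q \<phi>" and "well_typed Q"
    and e: "(flex_app \<Gamma> F ns, flex_app \<Gamma> G ms) \<in> Q"
    and prunes: "prunes \<Gamma> arg {F, G} H ks" and fresh: "H \<notin> A \<union> cvars Q \<phi>"
  defines "\<theta> \<equiv> prune_subst \<Gamma> arg {F, G} H ks"
  shows "linear_within A V (Papp \<theta> (Q - {(flex_app \<Gamma> F ns, flex_app \<Gamma> G ms)})) (comp \<phi> \<theta>)"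
proof -
  let ?R = "Q - {(flex_app \<Gamma> F ns, flex_app \<Gamma> G ms)}"
  have lin: "lhs_linear Q" using form by (simp add: linear_within_def)
  have \<theta>: "typed_subst \<theta>" "Dom \<theta> \<subseteq> {F, G}" "\<And>X. fv (\<theta> X) \<subseteq> {X, H}"
    using is_subst_prune_subst[OF prunes] Dom_prune_subst fv_prune_subst
    by (auto simp: \<theta>_def del: subsetI)
  have FG: "F \<in> lhs_vars Q" "G \<in> rhs_vars Q" using e by (force simp: lhs_vars_def rhs_vars_def)+
  have R: "lhs_vars ?R \<subseteq> lhs_vars Q" "vars ?R \<subseteq> vars Q" by (auto simp: lhs_vars_def rhs_vars_def)
  have "F \<notin> lhs_vars ?R" using lhs_linear_occurs(2)[OF lin e] by simp
  moreover have "G \<notin> lhs_vars ?R" using lin FG(2) R(1) by (auto simp: lhs_linear_def disjnt_def)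
  ultimately have Dom: "lhs_vars ?R \<inter> Dom \<theta> = {}" using \<theta>(2) by blast
  have H: "H \<notin> lhs_vars ?R" using fresh R(1) by (auto simp: cvars_eq)
  have R': "lhs_linear ?R" "well_typed ?R"
    using lhs_linear_subset[OF lin, of ?R] well_typed_subset[OF assms(2), of ?R] by auto
  show ?thesis
  proof (rule linear_within_update[OF form, where N = "{H}"])
    show "lhs_linear (Papp \<theta> ?R)" by (rule lhs_linear_Papp(1)[OF R' \<theta>(1) Dom \<theta>(3) H])
    show "vars (Papp \<theta> ?R) \<subseteq> vars Q \<union> {H}"
      using lhs_linear_Papp(2)[OF R' \<theta>(1) Dom \<theta>(3) H] R(2) by blast
    show "Dom (comp \<phi> \<theta>) \<subseteq> Dom \<phi> \<union> vars Q" using Dom_comp_subset[OF \<theta>(1)] \<theta>(2) FG by blast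
  qed (use fresh in simp)
qed

lemma linear_within_step:
  assumes "ve_step A (Q, \<phi>) (Q', \<phi>')" "well_typed Q" "linear_within A V Q \<phi>"
  shows "linear_within A V Q' \<phi>'"
  using assms(1,2)
proof (cases rule: ve_step_cases)
  case (Abs T t s)
  then show ?thesis using linear_within_Abs[OF assms(3)] by simp
next
  case (Imitate \<Gamma> F ns a ss Hs)
  then have "length ss = length Hs" by (simp add: imitates_length list_all2_lengthD)
  then show ?thesis
    using linear_within_Imitate[OF assms(3) Imitate(1,2) _ Imitate(4)] Imitate(5,6) by simp
next
  case (Prune \<Gamma> F ns G ms H \<theta>)
  then show ?thesis using linear_within_Prune[OF assms(3,2) Prune(1,4,5)] by simp
qed

context similarity_degree
begin

lemma completion_imitate:
  assumes compl: "completion W \<tau> Q \<phi> \<psi>" and lin: "lhs_linear Q"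
    and e: "(flex_app \<Gamma> F ns, Ap a ss) \<in> Q" and im: "imitates \<Gamma> F ns a Hs"
    and ss: "list_all2 (hopat \<Gamma>) ss (argtys (headty a))"
    and fresh: "set Hs \<inter> (W \<union> cvars Q \<phi>) = {}"
  defines "Q' \<equiv> set (zip (imitation_args \<Gamma> ns a Hs) ss) \<union>
      (Q - {(flex_app \<Gamma> F ns, Ap a ss)})"
  obtains \<psi>' where "completion W \<tau> Q' (comp \<phi> (imitation_subst \<Gamma> F ns a Hs)) \<psi>'"
    "total_weight \<psi>' Q' < total_weight \<psi> Q"
proof -
  let ?S = "W \<union> cvars Q \<phi>" and ?Es = "imitation_args \<Gamma> ns a Hs"
  let ?\<theta> = "imitation_subst \<Gamma> F ns a Hs" and ?R = "Q - {(flex_app \<Gamma> F ns, Ap a ss)}"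
  have Q: "well_typed Q" "is_subst \<psi>" "unifies \<psi> Q" using compl by (simp_all add: completion_def)
  obtain \<psi>' us where \<psi>': "is_subst \<psi>'" "\<And>X. X \<in> ?S \<Longrightarrow> \<psi>' X = \<psi> X" "sim_on ?S (comp ?\<theta> \<psi>') \<psi>"
    and us: "map (sapp \<psi>') ?Es = us" "list_all2 sim us (map (sapp \<psi>) ss)"
      "tsize (sapp \<psi> (flex_app \<Gamma> F ns)) = Suc (\<Sum>u\<leftarrow>us. Suc (tsize u))"
    using imitation_unifierE[OF im Q(2) fresh unifiesD[OF Q(3) e]] by metis
  have "sapp \<psi>' s = sapp \<psi> s" if s: "s \<in> set ss" for s
  proof -
    obtain T where T: "hopat \<Gamma> s T"
      using ss s by (auto simp: list_all2_conv_all_nth in_set_conv_nth)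
    have "fv s \<subseteq> ?S" using s fv_subset_cvars(2)[OF e, of \<phi>] by auto
    then show ?thesis using sapp_cong[OF T] \<psi>'(2) by blast
  qed
  then have "map (sapp \<psi>') ss = map (sapp \<psi>) ss" by simp
  then have unifies: "unifies \<psi>' (set (zip ?Es ss))" using us(1,2) unifies_zip by metis
  have "length ?Es = length ss" using imitates_length[OF im] list_all2_lengthD[OF ss] by simp
  from total_weight_zip[OF this, of \<psi>']
  have weight: "total_weight \<psi>' (set (zip ?Es ss)) < weight \<psi> (flex_app \<Gamma> F ns, Ap a ss)"
    using us(3) by (simp add: weight_def o_def flip: us(1))
  have "vars ?R \<inter> Dom ?\<theta> = {}"
    using lhs_linear_occurs(2)[OF lin e] Dom_single[of F] by auto
  then have "Papp ?\<theta> ?R = ?R" using well_typed_subset[OF Q(1), of ?R] by (intro Papp_ident) auto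
  then show thesis
    using that completion_step[OF compl e is_subst_imitation_subst[OF im] \<psi>'(1,3) _
        well_typed_zip[OF hopat_imitation_args[OF im] ss] unifies weight]
    by (simp add: Q'_def)
qed

lemma completion_prune:
  assumes compl: "completion W \<tau> P \<sigma> \<psi>" and e: "(flex_app \<Gamma> F ns, r) \<in> P"
    and prunes: "prunes \<Gamma> arg D H ks" and fresh: "H \<notin> W \<union> cvars P \<sigma>"
    and "F \<in> D" "arg F = ns" "bvars (sapp \<psi> (flex_app \<Gamma> F ns)) \<subseteq> set ks"
    and "\<And>G. G \<in> D \<Longrightarrow> sim (sapp \<psi> (flex_app \<Gamma> F ns)) (sapp \<psi> (flex_app \<Gamma> G (arg G)))"
  defines "\<theta> \<equiv> prune_subst \<Gamma> arg D H ks"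
  obtains \<psi>' where "completion W \<tau> (Papp \<theta> (P - {(flex_app \<Gamma> F ns, r)})) (comp \<sigma> \<theta>) \<psi>'"
    "total_weight \<psi>' (Papp \<theta> (P - {(flex_app \<Gamma> F ns, r)})) < total_weight \<psi> P"
proof -
  have F: "flex_args \<Gamma> F ns" "resty (snd F) = resty (snd H)"
    using prunes assms(5,6) by (auto simp: prunes_def)
  have \<psi>: "is_subst \<psi>" using compl by (simp add: completion_def)
  have "hopat \<Gamma> (sapp \<psi> (flex_app \<Gamma> F ns)) (resty (snd H))"
    using hopat_sapp[OF hopat_flexI[OF F(1)] is_subst_typed[OF \<psi>]] F(2) by simp
  then have "more_general Rc d (W \<union> cvars P \<sigma>) \<theta> \<psi>"
    unfolding \<theta>_def using assms(7,8) by (rule more_general_prune_subst[OF prunes \<psi> fresh])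
  then show thesis
    using completion_bind[OF compl e] is_subst_prune_subst[OF prunes] that unfolding \<theta>_def by blast
qed

lemma completion_ve_step:
  assumes compl: "completion W \<tau> Q \<phi> \<psi>" and lin: "lhs_linear Q"
    and step: "ve_step W (Q, \<phi>) (Q', \<phi>')"
  obtains \<psi>' where "completion W \<tau> Q' \<phi>' \<psi>'" "total_weight \<psi>' Q' < total_weight \<psi> Q"
proof -
  have Q: "well_typed Q" "is_subst \<psi>" "unifies \<psi> Q" using compl by (simp_all add: completion_def)
  from step Q(1) show thesis
  proof (cases rule: ve_step_cases)
    case (Abs T t s)
    then show thesis using that completion_Lam[OF compl Abs(1)] by blast
  next
    case (Imitate \<Gamma> F ns a ss Hs)
    then show thesis using that completion_imitate[OF compl lin Imitate(1-4)] by metis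
  next
    case (Prune \<Gamma> F ns G ms H \<theta>)
    note sim = unifiesD[OF Q(3) Prune(1)]
    have args: "length ns = length (argtys (snd F))" "length ms = length (argtys (snd G))"
      using Prune(2,4) by (auto simp: prunes_def flex_args_length)
    have "bvars (sapp \<psi> (flex_app \<Gamma> F ns)) \<subseteq> set ns" "bvars (sapp \<psi> (flex_app \<Gamma> F ns)) \<subseteq> set ms"
      using bvars_sapp_flex_app[OF is_subst_typed[OF Q(2)]] args sim_bvars[OF sim] by blast+
    then have "bvars (sapp \<psi> (flex_app \<Gamma> F ns)) \<subseteq> set (common_args ns ms)" by auto
    then obtain \<psi>' where "completion W \<tau> Q' \<phi>' \<psi>'" "total_weight \<psi>' Q' < total_weight \<psi> Q"
      unfolding Prune(3,6,7)
      by (rule completion_prune[OF compl Prune(1,4,5), rotated 2]) (use sim Prune(2) in auto)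
    then show thesis using that by blast
  qed
qed

fun var_elim_inv :: "var set \<Rightarrow> var set \<Rightarrow> subst \<Rightarrow> nat \<Rightarrow> eqn set \<times> subst \<Rightarrow> bool" where
  "var_elim_inv A V \<tau> n (Q, \<phi>) \<longleftrightarrow>
     (\<exists>\<psi>. completion A \<tau> Q \<phi> \<psi> \<and> linear_within A V Q \<phi> \<and> total_weight \<psi> Q = n)"

lemma descending_var_elim_inv: "descending (ve_step A) (var_elim_inv A V \<tau>)"
  unfolding descending_def
proof (intro allI impI)
  fix n c c' assume inv: "var_elim_inv A V \<tau> n c" and step: "ve_step A c c'"
  obtain Q \<phi> Q' \<phi>' where c: "c = (Q, \<phi>)" "c' = (Q', \<phi>')" by (cases c; cases c')
  obtain \<psi> where \<psi>: "completion A \<tau> Q \<phi> \<psi>" "linear_within A V Q \<phi>" "total_weight \<psi> Q = n"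
    using inv c(1) by auto
  have "linear_within A V Q' \<phi>'"
    using linear_within_step[OF step[unfolded c] _ \<psi>(2)] \<psi>(1) by (simp add: completion_def)
  moreover obtain \<psi>' where "completion A \<tau> Q' \<phi>' \<psi>'" "total_weight \<psi>' Q' < total_weight \<psi> Q"
    using completion_ve_step[OF \<psi>(1) _ step[unfolded c]] \<psi>(2) by (auto simp: linear_within_def)
  ultimately show "\<exists>m<n. var_elim_inv A V \<tau> m c'" using \<psi>(3) c(2) by auto
qed

lemma ve_step_progress:
  assumes compl: "completion A \<tau> Q \<phi> \<psi>" and lin: "lhs_linear Q" and "Q \<noteq> {}" "finite A"
  shows "\<exists>c. ve_step A (Q, \<phi>) c"
proof -
  have Q: "well_typed Q" "typed_subst \<psi>" "unifies \<psi> Q" and fin: "finite (A \<union> cvars Q \<phi>)"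
    using compl assms(4) finite_cvars by (auto simp: completion_def)
  obtain l r where e: "(l, r) \<in> Q" using assms(3) by auto
  note sim = unifiesD[OF Q(3) e]
  have flex: "flex_headed l" using lin e by (auto simp: lhs_linear_def)
  obtain \<Gamma> T where pat: "hopat \<Gamma> l T" "hopat \<Gamma> r T" using well_typedE[OF Q(1) e] .
  from pat show ?thesis
  proof (cases rule: hopat_pair_cases)
    case (Lam S t' s')
    then show ?thesis using ve_abs[OF refl] e by blast
  next
    case (Flex_Rigid F xs a ss)
    then obtain ns where ns: "l = flex_app \<Gamma> F ns" "flex_args \<Gamma> F ns" "T = resty (snd F)"
      using pat(1) by (auto simp: hopat_flex_iff)
    have a: "rigid_in \<Gamma> a" "resty (headty a) = resty (snd F)"
      "length ss = length (argtys (headty a))"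
      using pat(2) Flex_Rigid(2,3) ns(3) by (auto simp: hopat_rigid_iff list_all2_lengthD)
    have "imitable a (bvatoms \<Gamma> ns)"
      using imitable_of_sim[OF ns(2) _ Flex_Rigid(3) Q(2)] pat(2) sim ns(1) Flex_Rigid(2) by blast
    then obtain Hs where im: "imitates \<Gamma> F ns a Hs" and fresh: "set Hs \<inter> (A \<union> cvars Q \<phi>) = {}"
      using fresh_imitation[OF ns(2) a(1) _ a(2) fin] by blast
    have "length Hs = length ss" using imitates_length[OF im] a(3) by simp
    then show ?thesis using ve_step_imitate[OF im _ _ fresh] e ns(1) Flex_Rigid(2) by metis
  next
    case (Flex_Flex F xs G ys)
    then obtain ns ms where args: "l = flex_app \<Gamma> F ns" "flex_args \<Gamma> F ns" "r = flex_app \<Gamma> G ms"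
      "flex_args \<Gamma> G ms"
      using pat by (auto simp: hopat_flex_iff)
    have "F \<noteq> G" using lhs_linear_occurs(1)[OF lin e] args by auto
    moreover obtain H
      where "snd H = arrows (map typeof (bvatoms \<Gamma> (common_args ns ms))) (resty (snd F))"
        "H \<notin> A \<union> cvars Q \<phi>"
      using fresh_var[OF fin] by blast
    ultimately show ?thesis using ve_step_prune[OF args(2,4)] e args(1,3) by blast
  qed (use flex in auto)
qed

lemma var_elim_inv_init:
  assumes "flex_args \<Gamma> F ns" "hopat \<Gamma> u (resty (snd F))" "is_subst \<psi>"
    and "sim (sapp \<psi> (flex_app \<Gamma> F ns)) (sapp \<psi> u)" "F \<notin> fv u"
  obtains n where "var_elim_inv A ({F} \<union> fv u) \<psi> n ({(flex_app \<Gamma> F ns, u)}, eps)"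
proof -
  have "linear_within A ({F} \<union> fv u) {(flex_app \<Gamma> F ns, u)} eps"
    using assms(5) by (auto simp: linear_within_def lhs_linear_def Dom_def eps_def)
  moreover have "completion A \<psi> {(flex_app \<Gamma> F ns, u)} eps \<psi>"
    using completion_init[OF hopat_flexI[OF assms(1)] assms(2-4)] .
  ultimately show thesis using that by auto
qed

lemma var_elim_exists:
  assumes "flex_args \<Gamma> F ns" "hopat \<Gamma> u (resty (snd F))" "is_subst \<psi>"
    and "sim (sapp \<psi> (flex_app \<Gamma> F ns)) (sapp \<psi> u)" "F \<notin> fv u" "finite A"
  shows "\<exists>\<phi>. var_elim A (flex_app \<Gamma> F ns) u \<phi>"
proof -
  let ?inv = "var_elim_inv A ({F} \<union> fv u) \<psi>" and ?c = "({(flex_app \<Gamma> F ns, u)}, eps)"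
  obtain n where n: "?inv n ?c" using var_elim_inv_init[OF assms(1-5)] .
  obtain Q \<phi> where run: "(ve_step A)\<^sup>*\<^sup>* ?c (Q, \<phi>)" and fin: "final (ve_step A) (Q, \<phi>)"
    using terminates_imp_final[OF descending_terminates[OF descending_var_elim_inv n]] by auto
  obtain \<psi>' where "completion A \<psi> Q \<phi> \<psi>'" "linear_within A ({F} \<union> fv u) Q \<phi>"
    using descending_reachable[OF descending_var_elim_inv run n] by auto
  then have "Q = {}"
    using ve_step_progress assms(6) fin unfolding linear_within_def final_def by blast
  then show ?thesis using run by (auto simp: var_elim_def)
qed

lemma var_elim_more_general:
  assumes "flex_args \<Gamma> F ns" "hopat \<Gamma> u (resty (snd F))" "is_subst \<psi>"
    and "sim (sapp \<psi> (flex_app \<Gamma> F ns)) (sapp \<psi> u)" "F \<notin> fv u"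
    and run: "var_elim A (flex_app \<Gamma> F ns) u \<phi>"
  defines "\<theta> \<equiv> restrict \<phi> ({F} \<union> fv u)"
  shows "is_subst \<theta>" "more_general Rc d A \<theta> \<psi>"
proof -
  let ?V = "{F} \<union> fv u"
  obtain n where n: "var_elim_inv A ?V \<psi> n ({(flex_app \<Gamma> F ns, u)}, eps)"
    using var_elim_inv_init[OF assms(1-5)] .
  obtain \<psi>' where compl: "completion A \<psi> {} \<phi> \<psi>'" and form: "linear_within A ?V {} \<phi>"
    using descending_reachable[OF descending_var_elim_inv run[unfolded var_elim_def] n] by auto
  note \<phi> = completion_more_general[OF compl]
  have restrict: "\<theta> = override_on eps \<phi> ?V"
    by (simp add: \<theta>_def restrict_def override_on_def eps_def fun_eq_iff)
  show "is_subst \<theta>"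
    unfolding restrict using \<phi>
    by (intro is_subst_override_on[OF is_subst_eps]) (simp_all add: typed_substD is_subst_typed)
  have "\<theta> X = \<phi> X" if "X \<in> A" for X
  proof (cases "X \<in> ?V")
    case False
    then have "X \<notin> Dom \<phi>" using form that unfolding linear_within_def by blast
    then show ?thesis using False by (simp add: restrict Dom_def eps_def)
  qed (simp add: restrict)
  then show "more_general Rc d A \<theta> \<psi>" using \<phi> by (simp add: more_general_def)
qed

end

section \<open>HOPSU\<close>

lemma prunes_agreeing:
  assumes "flex_args \<Gamma> F ns" "flex_args \<Gamma> F ms"
    and "zs = map fst (filter (\<lambda>(x, y). x = y) (zip (bvatoms \<Gamma> ns) (bvatoms \<Gamma> ms)))"
    and "snd H = arrows (map typeof zs) (resty (snd F))"
  shows "prunes \<Gamma> (\<lambda>_. ns) {F} H (agreeing ns ms)"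
    and "single F (abstr (argtys (snd F)) (bvatoms \<Gamma> ns) (Ap (FV H) zs)) =
      prune_subst \<Gamma> (\<lambda>_. ns) {F} H (agreeing ns ms)"
proof -
  have zs: "zs = bvatoms \<Gamma> (agreeing ns ms)"
    using assms(3) agreeing_bvatoms[of \<Gamma> ns ms] by (simp add: agreeing_def)
  have "length ns = length ms" using assms(1,2) by (simp add: flex_args_length)
  then have "distinct (agreeing ns ms)"
    using assms(1) by (intro distinct_agreeing) (simp_all add: flex_args_def)
  then show "prunes \<Gamma> (\<lambda>_. ns) {F} H (agreeing ns ms)"
    using flex_args_sublist[OF assms(1) _ set_agreeing_subset assms(4)[unfolded zs]] assms(1)
    by (simp add: prunes_def set_agreeing_subset)
  show "single F (abstr (argtys (snd F)) (bvatoms \<Gamma> ns) (Ap (FV H) zs)) =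
      prune_subst \<Gamma> (\<lambda>_. ns) {F} H (agreeing ns ms)"
    by (simp add: single_def prune_subst_def override_on_def eps_def fun_eq_iff zs
        abstr_eq_abstract_bvs[OF assms(1)])
qed

lemma hstep0_SV_exists:
  assumes "flex_args \<Gamma> F ns" "flex_args \<Gamma> F ms" "finite (W \<union> cvars (insert e P) \<sigma>)"
    and "e = (flex_app \<Gamma> F ns, flex_app \<Gamma> F ms)"
  shows "\<exists>c. hstep0 Rc \<mu> W e P \<sigma> \<delta> c"
proof -
  let ?zs = "map fst (filter (\<lambda>(x, y). x = y) (zip (bvatoms \<Gamma> ns) (bvatoms \<Gamma> ms)))"
  obtain H where H: "snd H = arrows (map typeof ?zs) (resty (snd F))" "H \<notin> W \<union> cvars (insert e P) \<sigma>"
    using assms(3) by (rule fresh_var)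
  have "length (bvatoms \<Gamma> ns) = length (bvatoms \<Gamma> ms)"
    using assms(1,2) by (simp add: flex_args_length)
  then show ?thesis using hstep0.SV[OF assms(4) _ _ _ refl H(2,1) refl] by auto
qed

context similarity_degree
begin

lemma completion_Dec:
  assumes compl: "completion W \<tau> P \<sigma> \<psi>" and e: "(Ap f ts, Ap g ss) \<in> P"
    and rigid: "rigid f" "rigid g"
  shows "completion W \<tau> (set (zip ts ss) \<union> (P - {(Ap f ts, Ap g ss)})) \<sigma> \<psi>"
    and "total_weight \<psi> (set (zip ts ss) \<union> (P - {(Ap f ts, Ap g ss)})) < total_weight \<psi> P"
    and "d \<le> RA Rc f g"
proof -
  have P: "well_typed P" "unifies \<psi> P" using compl by (simp_all add: completion_def)
  have sim: "sim_head f g" "list_all2 sim (map (sapp \<psi>) ts) (map (sapp \<psi>) ss)"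
    using unifiesD[OF P(2) e] rigid by simp_all
  then show "d \<le> RA Rc f g" by (simp add: sim_head_def)
  obtain \<Gamma> T where "hopat \<Gamma> (Ap f ts) T" "hopat \<Gamma> (Ap g ss) T" using well_typedE[OF P(1) e] .
  then have "list_all2 (hopat \<Gamma>) ts (argtys (headty f))"
    "list_all2 (hopat \<Gamma>) ss (argtys (headty f))"
    using rigid sim_head_headty[OF sim(1)] by (simp_all add: hopat_rigid_iff)
  then have typed: "well_typed (set (zip ts ss))" by (rule well_typed_zip)
  have "length ts = length ss" using list_all2_lengthD[OF sim(2)] by simp
  from total_weight_zip[OF this, of \<psi>]
  have weight: "total_weight \<psi> (set (zip ts ss)) < weight \<psi> (Ap f ts, Ap g ss)"
    using rigid by (simp add: weight_def o_def)
  show "completion W \<tau> (set (zip ts ss) \<union> (P - {(Ap f ts, Ap g ss)})) \<sigma> \<psi>"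
    "total_weight \<psi> (set (zip ts ss) \<union> (P - {(Ap f ts, Ap g ss)})) < total_weight \<psi> P"
    by (rule completion_replace[OF compl e _ typed unifies_zip[OF sim(2)] weight]; simp)+
qed

lemma completion_SV:
  assumes compl: "completion W \<tau> P \<sigma> \<psi>" and e: "e \<in> P" "e = (Ap (FV F) xs, Ap (FV F) ys)"
    and zs: "zs = map fst (filter (\<lambda>(x, y). x = y) (zip xs ys))"
    and H: "H \<notin> W \<union> cvars P \<sigma>" "snd H = arrows (map typeof zs) (resty (snd F))"
    and \<theta>: "\<theta> = single F (abstr (argtys (snd F)) xs (Ap (FV H) zs))"
  obtains \<psi>' where "completion W \<tau> (Papp \<theta> (P - {e})) (comp \<sigma> \<theta>) \<psi>'"
    "total_weight \<psi>' (Papp \<theta> (P - {e})) < total_weight \<psi> P"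
proof -
  have P: "well_typed P" "is_subst \<psi>" "unifies \<psi> P" using compl by (simp_all add: completion_def)
  obtain \<Gamma> T where "hopat \<Gamma> (Ap (FV F) xs) T" "hopat \<Gamma> (Ap (FV F) ys) T"
    using well_typedE[OF P(1)] e by blast
  then obtain ns ms where args: "xs = bvatoms \<Gamma> ns" "flex_args \<Gamma> F ns" "ys = bvatoms \<Gamma> ms"
    "flex_args \<Gamma> F ms"
    by (auto simp: hopat_flex_iff)
  note prune = prunes_agreeing[OF args(2,4) zs[unfolded args(1,3)] H(2)]
  have "bvars (sapp \<psi> (flex_app \<Gamma> F ns)) \<subseteq> set (agreeing ns ms)"
    using args(2,4) unifiesD[OF P(3)] e args(1,3)
    by (intro bvars_sapp_agreeing[OF is_subst_typed[OF P(2)]]) (simp_all add: flex_args_length)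
  then show thesis
    using completion_prune[OF compl e(1)[unfolded e(2) args(1)] prune(1) H(1)] that
    unfolding \<theta> args(1) prune(2) e(2) by auto
qed

lemma completion_Ori:
  assumes compl: "completion W \<tau> P \<sigma> \<psi>" and e: "(Ap a ss, Ap (FV F) xs) \<in> P" and rigid: "rigid a"
  defines "P' \<equiv> insert (Ap (FV F) xs, Ap a ss) (P - {(Ap a ss, Ap (FV F) xs)})"
  shows "completion W \<tau> P' \<sigma> \<psi>" "total_weight \<psi> P' < total_weight \<psi> P"
proof -
  have P: "well_typed P" "unifies \<psi> P" using compl by (simp_all add: completion_def)
  note sim = unifiesD[OF P(2) e]
  have typed: "well_typed {(Ap (FV F) xs, Ap a ss)}"
    using well_typedE[OF P(1) e] well_typed_singleton by metis
  have weight: "total_weight \<psi> {(Ap (FV F) xs, Ap a ss)} < weight \<psi> (Ap a ss, Ap (FV F) xs)"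
    using sim_tsize[OF sim] rigid by (auto simp: total_weight_def weight_def)
  have unifies: "unifies \<psi> {(Ap (FV F) xs, Ap a ss)}" using sim_sym[OF sim] by simp
  note replace =
    completion_replace[OF compl e _ typed unifies weight, unfolded insert_is_Un[symmetric]]
  show "completion W \<tau> P' \<sigma> \<psi>" "total_weight \<psi> P' < total_weight \<psi> P"
    unfolding P'_def by (rule replace; simp)+
qed

lemma completion_LF:
  assumes compl: "completion W \<tau> P \<sigma> \<psi>" and e: "e \<in> P" "e = (Ap (FV F) xs, u)" and "F \<notin> fv u"
    and run: "var_elim (W \<union> cvars P \<sigma>) (Ap (FV F) xs) u \<phi>"
    and \<theta>: "\<theta> = restrict \<phi> ({F} \<union> fv u)"
  obtains \<psi>' where "completion W \<tau> (Papp \<theta> (P - {e})) (comp \<sigma> \<theta>) \<psi>'"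
    "total_weight \<psi>' (Papp \<theta> (P - {e})) < total_weight \<psi> P"
proof -
  have P: "well_typed P" "is_subst \<psi>" "unifies \<psi> P" using compl by (simp_all add: completion_def)
  obtain \<Gamma> T where "hopat \<Gamma> (Ap (FV F) xs) T" "hopat \<Gamma> u T" using well_typedE[OF P(1)] e by blast
  then obtain ns where args: "xs = bvatoms \<Gamma> ns" "flex_args \<Gamma> F ns" "hopat \<Gamma> u (resty (snd F))"
    by (auto simp: hopat_flex_iff)
  have "sim (sapp \<psi> (flex_app \<Gamma> F ns)) (sapp \<psi> u)" using unifiesD[OF P(3)] e args(1) by blast
  note general =
    var_elim_more_general[OF args(2,3) P(2) this assms(4) run[unfolded args(1)], folded \<theta>]
  show thesis using completion_bind[OF compl e(1) general] that by blast
qed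

fun hopsu_inv :: "var set \<Rightarrow> subst \<Rightarrow> nat \<Rightarrow> config \<Rightarrow> bool" where
  "hopsu_inv W \<tau> n (Conf P \<sigma> \<delta>) \<longleftrightarrow>
     d \<le> \<delta> \<and> (\<exists>\<psi>. completion W \<tau> P \<sigma> \<psi> \<and> total_weight \<psi> P = n)"
| "hopsu_inv W \<tau> n Bot \<longleftrightarrow> False"

lemma hstep0_decreases:
  assumes compl: "completion W \<tau> P \<sigma> \<psi>" and e: "e \<in> P" and "d \<le> \<delta>"
    and step: "hstep0 Rc \<mu> W e (P - {e}) \<sigma> \<delta> c"
  shows "\<exists>m<total_weight \<psi> P. hopsu_inv W \<tau> m c"
proof -
  have ins: "insert e (P - {e}) = P" using e by blast
  from step show ?thesis
  proof cases
    case (Abs T t s)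
    then show ?thesis using completion_Lam[OF compl, of T t s] e assms(3) by auto
  next
    case (Dec f ts g ss)
    then show ?thesis using completion_Dec[OF compl, of f ts g ss] e assms(3) by auto
  next
    case (SV F xs ys zs H \<theta>)
    obtain \<psi>' where "completion W \<tau> (Papp \<theta> (P - {e})) (comp \<sigma> \<theta>) \<psi>'"
      "total_weight \<psi>' (Papp \<theta> (P - {e})) < total_weight \<psi> P"
      using completion_SV[OF compl e SV(2,6) SV(7)[unfolded ins] SV(8,9)] by blast
    then show ?thesis using SV(1) assms(3) by auto
  next
    case (Ori a ss F xs)
    then have "rigid a" by auto
    then show ?thesis using completion_Ori[OF compl, of a ss F xs] Ori(1,2) e assms(3) by auto
  next
    case (LF F xs u a ss \<phi> \<theta>)
    obtain \<psi>' where "completion W \<tau> (Papp \<theta> (P - {e})) (comp \<sigma> \<theta>) \<psi>'"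
      "total_weight \<psi>' (Papp \<theta> (P - {e})) < total_weight \<psi> P"
      using completion_LF[OF compl e LF(2,5) LF(7)[unfolded ins] LF(8)] by blast
    then show ?thesis using LF(1) assms(3) by auto
  qed
qed

lemma hstep0_LF_exists:
  assumes "flex_args \<Gamma> F ns" "hopat \<Gamma> (Ap a ss) (resty (snd F))" "is_subst \<psi>"
    and "sim (sapp \<psi> (flex_app \<Gamma> F ns)) (sapp \<psi> (Ap a ss))" "F \<notin> fv (Ap a ss)"
    and "finite (W \<union> cvars (insert e P) \<sigma>)" "e = (flex_app \<Gamma> F ns, Ap a ss)"
  shows "\<exists>c. hstep0 Rc \<mu> W e P \<sigma> \<delta> c"
proof -
  obtain \<phi> where run: "var_elim (W \<union> cvars (insert e P) \<sigma>) (flex_app \<Gamma> F ns) (Ap a ss) \<phi>"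
    using var_elim_exists[OF assms(1-6)] by blast
  have "(\<exists>c. a = C c) \<or> (\<exists>G. a = FV G) \<or> (\<exists>j S. a = BV j S \<and> Ap a [] \<in> set (bvatoms \<Gamma> ns))"
    using imitable_of_sim[OF assms(1,2) _ is_subst_typed[OF assms(3)] assms(4)] rigid_or_flex[of a]
    unfolding imitable_def by blast
  then show ?thesis using hstep0.LF[OF assms(7) refl _ assms(5) _ run refl] by auto
qed

lemma hstep0_Ori_exists:
  assumes "flex_args \<Gamma> F ns" "hopat \<Gamma> (Ap a ss) T" "rigid a" "typed_subst \<psi>"
    and "sim (sapp \<psi> (Ap a ss)) (sapp \<psi> (flex_app \<Gamma> F ns))"
  shows "\<exists>c. hstep0 Rc \<mu> W (Ap a ss, flex_app \<Gamma> F ns) P \<sigma> \<delta> c"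
proof -
  have "imitable a (bvatoms \<Gamma> ns)" using imitable_of_sim[OF assms(1-4) sim_sym[OF assms(5)]] .
  then show ?thesis
    unfolding imitable_def by (intro exI) (rule hstep0.Ori[OF refl], simp_all)
qed

lemma hstep0_flex_exists:
  assumes F: "flex_args \<Gamma> F ns" and a: "hopat \<Gamma> (Ap a ss) (resty (snd F))" and "is_subst \<psi>"
    and sim: "sim (sapp \<psi> (flex_app \<Gamma> F ns)) (sapp \<psi> (Ap a ss))"
    and fin: "finite (W \<union> cvars (insert e P) \<sigma>)" and e: "e = (flex_app \<Gamma> F ns, Ap a ss)"
  shows "\<exists>c. hstep0 Rc \<mu> W e P \<sigma> \<delta> c"
proof (cases "a = FV F")
  case True
  then obtain ms where "ss = bvatoms \<Gamma> ms" "flex_args \<Gamma> F ms" using a by (auto simp: hopat_flex_iff)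
  then show ?thesis using hstep0_SV_exists[OF F _ fin] e True by simp
next
  case False
  have "F \<notin> fv (Ap a ss)"
  proof (cases "rigid a")
    case True
    then show ?thesis using occurs_check_of_sim[OF F a _ sim] by blast
  next
    case flex: False
    then obtain G where G: "a = FV G" using rigid_or_flex by blast
    then obtain ms where "ss = bvatoms \<Gamma> ms" using a by (auto simp: hopat_flex_iff)
    then show ?thesis using False G by simp
  qed
  then show ?thesis using hstep0_LF_exists[OF F a assms(3) sim _ fin e] by blast
qed

lemma hstep0_progress:
  assumes compl: "completion W \<tau> P \<sigma> \<psi>" and e: "(l, r) \<in> P"
    and "d \<le> \<delta>" "\<mu> \<le> d" "finite W"
  shows "\<exists>c. hstep0 Rc \<mu> W (l, r) (P - {(l, r)}) \<sigma> \<delta> c"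
proof -
  have P: "well_typed P" "is_subst \<psi>" "unifies \<psi> P" using compl by (simp_all add: completion_def)
  have "finite (W \<union> cvars P \<sigma>)" using compl assms(5) finite_cvars by (simp add: completion_def)
  then have fin: "finite (W \<union> cvars (insert (l, r) (P - {(l, r)})) \<sigma>)"
    using e by (simp add: insert_absorb)
  note sim = unifiesD[OF P(3) e]
  have flex: ?thesis
    if lr: "l = Ap (FV F) xs" "r = Ap g ss" "hopat \<Gamma> l T" "hopat \<Gamma> r T" for F xs g ss \<Gamma> T
  proof -
    obtain ns where ns: "l = flex_app \<Gamma> F ns" "flex_args \<Gamma> F ns" "T = resty (snd F)"
      using lr(1,3) by (auto simp: hopat_flex_iff)
    show ?thesis
      by (rule hstep0_flex_exists[OF ns(2) _ P(2) _ fin]) (use lr(2,4) ns(1,3) sim in simp_all)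
  qed
  obtain \<Gamma> T where pat: "hopat \<Gamma> l T" "hopat \<Gamma> r T" using well_typedE[OF P(1) e] .
  from pat show ?thesis
  proof (cases rule: hopat_pair_cases)
    case (Lam S t' s')
    then show ?thesis using hstep0.Abs by blast
  next
    case (Rigid_Rigid h ts g ss)
    then have "sim_head h g" "length ts = length ss" using sim by (auto dest: list_all2_lengthD)
    moreover from this have "\<mu> \<le> min \<delta> (RA Rc h g)" using assms(3,4) by (simp add: sim_head_def)
    ultimately show ?thesis using Rigid_Rigid hstep0.Dec by blast
  next
    case (Rigid_Flex h ts G ys)
    then obtain ms where ms: "r = flex_app \<Gamma> G ms" "flex_args \<Gamma> G ms"
      using pat(2) by (auto simp: hopat_flex_iff)
    show ?thesis
      unfolding Rigid_Flex(1) ms(1)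
      by (rule hstep0_Ori_exists[OF ms(2) _ Rigid_Flex(3) is_subst_typed[OF P(2)]])
        (use pat(1) sim Rigid_Flex(1) ms(1) in simp_all)
  qed (use flex pat in blast)+
qed

lemma descending_hopsu_inv:
  assumes "\<mu> \<le> d" "finite W"
  shows "descending (hstep Rc \<mu> W) (hopsu_inv W \<tau>)"
  unfolding descending_def
proof (intro allI impI)
  fix n c c' assume inv: "hopsu_inv W \<tau> n c" and step: "hstep Rc \<mu> W c c'"
  obtain P \<sigma> \<delta> \<psi> where c: "c = Conf P \<sigma> \<delta>" and \<psi>: "d \<le> \<delta>" "completion W \<tau> P \<sigma> \<psi>"
    "total_weight \<psi> P = n"
    using inv by (cases c) auto
  show "\<exists>m<n. hopsu_inv W \<tau> m c'"
    using step unfolding c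
  proof cases
    case (rule e)
    then show ?thesis using hstep0_decreases[OF \<psi>(2) _ \<psi>(1)] \<psi>(3) by blast
  next
    case (Fail e)
    then show ?thesis using hstep0_progress[OF \<psi>(2) _ \<psi>(1) assms] by (cases e) blast
  qed
qed

lemma hopsu_inv_final:
  assumes "hopsu_inv W \<tau> n c" "final (hstep Rc \<mu> W) c"
  obtains \<sigma> \<delta> where "c = Conf {} \<sigma> \<delta>" "d \<le> \<delta>" "more_general Rc d W \<sigma> \<tau>"
proof -
  obtain P \<sigma> \<delta> \<psi> where c: "c = Conf P \<sigma> \<delta>" "d \<le> \<delta>" "completion W \<tau> P \<sigma> \<psi>"
    using assms(1) by (cases c) auto
  have "P = {}" using assms(2) unfolding c(1) final_def by (blast intro: hstep.intros)
  then show thesis using that c completion_more_general by blast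
qed

end

theorem theorem4:
  fixes Rc :: "const \<Rightarrow> const \<Rightarrow> real" and \<mu> :: real
    and t s :: trm and T :: ty and \<tau> :: subst and d\<tau> :: real and W :: "var set"
  assumes "similarity Rc" and "0 < \<mu>" and "\<mu> \<le> 1"
    and "hopat [] t T" and "hopat [] s T"
    and "is_subst \<tau>" and "unifier_deg Rc \<mu> \<tau> t s d\<tau>"
    and "finite W" and "fv t \<union> fv s \<union> Dom \<tau> \<subseteq> W"
  shows "terminates (hstep Rc \<mu> W) (Conf {(t, s)} eps 1) \<and>
         (\<forall>c. (hstep Rc \<mu> W)\<^sup>*\<^sup>* (Conf {(t, s)} eps 1) c \<and> final (hstep Rc \<mu> W) c \<longrightarrow>
              (\<exists>\<sigma> d. c = Conf {} \<sigma> d \<and> more_general Rc \<mu> (Dom \<tau>) \<sigma> \<tau> \<and> d \<ge> d\<tau>))"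
proof -
  have deg: "Rt Rc (sapp \<tau> t) (sapp \<tau> s) = d\<tau>" "\<mu> \<le> d\<tau>"
    using assms(7) by (simp_all add: unifier_deg_def)
  interpret similarity_degree Rc d\<tau>
    using assms(1,2) deg Rt_le_1(1)[OF assms(1)] by unfold_locales auto
  have "completion W \<tau> {(t, s)} eps \<tau>"
    using assms(4-6) deg(1) by (intro completion_init) (simp_all add: sim_iff_Rt)
  then obtain n where init: "hopsu_inv W \<tau> n (Conf {(t, s)} eps 1)" using d_le_1 by auto
  note descending = descending_hopsu_inv[OF deg(2) assms(8)]
  have "\<exists>\<sigma> d. c = Conf {} \<sigma> d \<and> more_general Rc \<mu> (Dom \<tau>) \<sigma> \<tau> \<and> d \<ge> d\<tau>"
    if run: "(hstep Rc \<mu> W)\<^sup>*\<^sup>* (Conf {(t, s)} eps 1) c" and "final (hstep Rc \<mu> W) c" for c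
  proof -
    obtain m where "hopsu_inv W \<tau> m c" using descending_reachable[OF descending run init] by blast
    then obtain \<sigma> \<delta> where "c = Conf {} \<sigma> \<delta>" "d\<tau> \<le> \<delta>" "more_general Rc d\<tau> W \<sigma> \<tau>"
      using \<open>final (hstep Rc \<mu> W) c\<close> by (rule hopsu_inv_final)
    then show ?thesis using more_general_mono[OF _ deg(2)] assms(9) by blast
  qed
  then show ?thesis using descending_terminates[OF descending init] by blast
qed

end
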